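(* Let $|\mathcal U|\ge 5$, let $\mathcal D\subseteq\mathcal R^{pc}$ be a rich domain, and let $f\colon\mathcal D^N\to\mathcal R$ be an Arrovian social welfare function. Then $f$ is affine utilitarian with positive weights, i.e., there are $w_1,\dots,w_n\in\mathbb R$ with $w_i>0$ for all $i\in N$ such that for all $R=(\succ_1,\dots,\succ_n)\in\mathcal D^N$ and all $(\phi_i)_{i\in N}\in\Phi^N$ with ${\succ_i}\equiv\phi_i$ for all $i\in N$, $f(R)\equiv\sum_{i\in N}w_i\phi_i$.
   Context: Outcomes. $\mathcal U$ is a non-empty finite set of alternatives; $\Delta$ is the set of all probability measures on $\mathcal U$, with the Euclidean topology inherited from $\mathbb R^{\mathcal U}$. Each $a\in\mathcal U$ is identified with the point mass on $a$ (a pure outcome). For $X\subseteq\mathcal U$, $\Delta_X=\{p\in\Delta: p(X)=1\}$. For $p,q\in\Delta$, $\lambda\in[0,1]$, $p\lambda q=\lambda p+(1-\lambda)q$. Preferences. A preference relation is an asymmetric binary relation $\succ$ on $\Delta$; $p\sim q$ means neither $p\succ q$ nor $q\succ p$; $p\succsim q$ means $p\succ q$ or $p\sim q$. $U(p)=\{q: q\succ p\}$, $L(p)=\{q: p\succ q\}$, $I(p)=\{q: p\sim q\}$. For a set $X$ of outcomes, ${\succ}|_X=\{(p,q)\in{\succ}: p,q\in X\}$. $\mathcal R$ is the set of preference relations satisfying, for all $p$: (continuity) $U(p)$ and $L(p)$ are open in $\Delta$; (convexity) $U(p)$, $L(p)$, $U(p)\cup I(p)$, $L(p)\cup I(p)$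 are convex; and (symmetry) for all $p,q,r\in\Delta$, $\lambda\in(0,1)$: if $q\sim\frac12p+\frac12r$ and $p\lambda r\sim\frac12p+\frac12q$, then $r\lambda p\sim\frac12r+\frac12q$. The empty relation $\emptyset$ is complete indifference. SSB functions. An SSB function is a map $\phi\colon\Delta\times\Delta\to\mathbb R$ with $\phi(p,q)=-\phi(q,p)$ that is linear (i.e. preserves convex combinations) in each argument; it represents $\succ$ (written ${\succ}\equiv\phi$) if $p\succ q\Leftrightarrow\phi(p,q)>0$ for all $p,q$. Every ${\succ}\in\mathcal R$ is represented by an SSB function, unique up to multiplication by a positive scalar. $\Phi$ is the set of SSB functions whose largest value is $1$, together with the zero function (which represents $\emptyset$). $\Phi^{pc}$ is the set of $\phi\in\Phi$ with $\phi(a,b)\in\{-1,0,1\}$ for all $a,b\in\mathcal U$, and $\mathcal R^{pc}=\{{\succ}\in\mathcal R: {\succ}\equiv\phi\text{ for some }\phi\in\Phi^{pc}\}$. Social welfare functions. $N=\{1,\dots,n\}$ with $n\ge2$ is the set of agents, $\mathcal D\subseteq\mathcal R$ a domain. A profile is $R=(\succ_1,\dots,\succ_n)\in\mathcal D^N$; restrictions $R|_X$ are componentwise. A social welfare function (SWF) is a map $f\colon\mathcal D^N\to\mathcal R$. It satisfies Pareto optimality if for all $p,q\in\Delta$, $R\in\mathcal D^N$ and ${\succ}=f(R)$: $p\succsim_iq$ for all $i\in N$ implies $p\succsim q$, and if additionally $p\succ_iq$ for some $i$ then $p\succ q$. It satisfies IIA if for all $R,\hat R\in\mathcal D^N$ and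 $X\subseteq\mathcal U$: $R|_{\Delta_X}=\hat R|_{\Delta_X}$ implies $f(R)|_{\Delta_X}=f(\hat R)|_{\Delta_X}$. It is Arrovian if it satisfies Pareto optimality and IIA. Rich domains. For a permutation $\pi$ of $\mathcal U$ and $p\in\Delta$, $p^\pi(\pi(a))=p(a)$; ${\succ}^\pi$ is defined by $p^\pi\succ^\pi q^\pi\Leftrightarrow p\succ q$. ${\succ}^{-1}$ is defined by $p\succ^{-1}q\Leftrightarrow q\succ p$. $\mathcal D\subseteq\mathcal R$ is rich if: (R1) for all ${\succ}\in\mathcal R$ and all permutations $\pi$ of $\mathcal U$, ${\succ}\in\mathcal D$ if and only if ${\succ}^\pi\in\mathcal D$; (R2) $\emptyset\in\mathcal D$; (R3) ${\succ}\in\mathcal D$ implies ${\succ}^{-1}\in\mathcal D$; (R4) for all ${\hat\succ}\in\mathcal D$ and all $X\subseteq\mathcal U$ with $|X|\le4$ there are ${\succ}\in\mathcal D$ and $a\in\mathcal U$ such that ${\succ}|_X={\hat\succ}|_X$ (restriction to the pure outcomes in $X$) and $x\succ a$ for all $x\in X$. *)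

theory Defs
  imports "HOL-Analysis.Analysis"
begin

text \<open>
  The alternatives are the elements of a type \<open>'a\<close> of class \<open>finite\<close> and the agents are the elements
  of a type \<open>'n\<close> of class \<open>finite\<close>. Probability measures on the alternatives are vectors in
  \<open>real ^ 'a\<close>, which carries the Euclidean topology and the convex structure.
\<close>

definition outcomes :: "(real ^ 'a::finite) set" where
  "outcomes = {p. (\<forall>a. 0 \<le> p $ a) \<and> (\<Sum>a\<in>UNIV. p $ a) = 1}"

definition outcomes_on :: "'a::finite set \<Rightarrow> (real ^ 'a) set" where
  "outcomes_on X = {p \<in> outcomes. (\<Sum>a\<in>X. p $ a) = 1}"

definition pure :: "'a::finite \<Rightarrow> real ^ 'a" where
  "pure a = axis a 1"

definition mix :: "real ^ 'a::finite \<Rightarrow> real \<Rightarrow> real ^ 'a \<Rightarrow> real ^ 'a" where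
  "mix p l q = l *\<^sub>R p + (1 - l) *\<^sub>R q"

text \<open>
  A binary relation on outcomes is a set of pairs, \<open>(p, q) \<in> P\<close> meaning that \<open>p\<close> is strictly
  preferred to \<open>q\<close>. Preference relations are contained in \<open>outcomes \<times> outcomes\<close>, so that equality
  of preference relations is equality of relations on outcomes.
\<close>

type_synonym 'a pref = "((real ^ 'a) \<times> (real ^ 'a)) set"

definition preference :: "'a::finite pref \<Rightarrow> bool" where
  "preference P \<longleftrightarrow> P \<subseteq> outcomes \<times> outcomes \<and> asym P"

definition indiff :: "'a::finite pref \<Rightarrow> real ^ 'a \<Rightarrow> real ^ 'a \<Rightarrow> bool" where
  "indiff P p q \<longleftrightarrow> p \<in> outcomes \<and> q \<in> outcomes \<and> (p, q) \<notin> P \<and> (q, p) \<notin> P"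

definition weakly_pref :: "'a::finite pref \<Rightarrow> real ^ 'a \<Rightarrow> real ^ 'a \<Rightarrow> bool" where
  "weakly_pref P p q \<longleftrightarrow> (p, q) \<in> P \<or> indiff P p q"

definition upper :: "'a::finite pref \<Rightarrow> real ^ 'a \<Rightarrow> (real ^ 'a) set" where
  "upper P p = {q \<in> outcomes. (q, p) \<in> P}"

definition lower :: "'a::finite pref \<Rightarrow> real ^ 'a \<Rightarrow> (real ^ 'a) set" where
  "lower P p = {q \<in> outcomes. (p, q) \<in> P}"

definition indiff_set :: "'a::finite pref \<Rightarrow> real ^ 'a \<Rightarrow> (real ^ 'a) set" where
  "indiff_set P p = {q \<in> outcomes. indiff P p q}"

definition continuous_pref :: "'a::finite pref \<Rightarrow> bool" where
  "continuous_pref P \<longleftrightarrow> (\<forall>p\<in>outcomes.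
     openin (top_of_set outcomes) (upper P p) \<and> openin (top_of_set outcomes) (lower P p))"

definition convex_pref :: "'a::finite pref \<Rightarrow> bool" where
  "convex_pref P \<longleftrightarrow> (\<forall>p\<in>outcomes.
     convex (upper P p) \<and> convex (lower P p) \<and>
     convex (upper P p \<union> indiff_set P p) \<and> convex (lower P p \<union> indiff_set P p))"

definition symmetric_pref :: "'a::finite pref \<Rightarrow> bool" where
  "symmetric_pref P \<longleftrightarrow>
     (\<forall>p\<in>outcomes. \<forall>q\<in>outcomes. \<forall>r\<in>outcomes. \<forall>l\<in>{0<..<1}.
        indiff P q (mix p (1/2) r) \<and> indiff P (mix p l r) (mix p (1/2) q)
        \<longrightarrow> indiff P (mix r l p) (mix r (1/2) q))"

definition Prefs :: "'a::finite pref set" where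
  "Prefs = {P. preference P \<and> continuous_pref P \<and> convex_pref P \<and> symmetric_pref P}"

text \<open>
  SSB functions are functions on \<open>outcomes \<times> outcomes\<close>. They are modelled by total functions of
  which only the values on \<open>outcomes \<times> outcomes\<close> are ever constrained or used.
\<close>

type_synonym 'a ssb_fun = "real ^ 'a \<Rightarrow> real ^ 'a \<Rightarrow> real"

definition SSB :: "'a::finite ssb_fun \<Rightarrow> bool" where
  "SSB \<phi> \<longleftrightarrow>
     (\<forall>p\<in>outcomes. \<forall>q\<in>outcomes. \<phi> p q = - \<phi> q p) \<and>
     (\<forall>p\<in>outcomes. \<forall>q\<in>outcomes. \<forall>r\<in>outcomes. \<forall>l\<in>{0..1}.
        \<phi> (mix p l q) r = l * \<phi> p r + (1 - l) * \<phi> q r \<and>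
        \<phi> r (mix p l q) = l * \<phi> r p + (1 - l) * \<phi> r q)"

definition represents :: "'a::finite ssb_fun \<Rightarrow> 'a pref \<Rightarrow> bool" where
  "represents \<phi> P \<longleftrightarrow> (\<forall>p\<in>outcomes. \<forall>q\<in>outcomes. (p, q) \<in> P \<longleftrightarrow> \<phi> p q > 0)"

definition Phi :: "'a::finite ssb_fun set" where
  "Phi = {\<phi>. SSB \<phi> \<and>
     ((\<exists>p\<in>outcomes. \<exists>q\<in>outcomes. \<phi> p q = 1) \<and> (\<forall>p\<in>outcomes. \<forall>q\<in>outcomes. \<phi> p q \<le> 1)
      \<or> (\<forall>p\<in>outcomes. \<forall>q\<in>outcomes. \<phi> p q = 0))}"

definition Phi_pc :: "'a::finite ssb_fun set" where
  "Phi_pc = {\<phi> \<in> Phi. \<forall>a b. \<phi> (pure a) (pure b) \<in> {-1, 0, 1}}"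

definition Prefs_pc :: "'a::finite pref set" where
  "Prefs_pc = {P \<in> Prefs. \<exists>\<phi>\<in>Phi_pc. represents \<phi> P}"

definition profiles :: "'a::finite pref set \<Rightarrow> ('n::finite \<Rightarrow> 'a pref) set" where
  "profiles D = {R. \<forall>i. R i \<in> D}"

definition SWF :: "'a::finite pref set \<Rightarrow> (('n::finite \<Rightarrow> 'a pref) \<Rightarrow> 'a pref) \<Rightarrow> bool" where
  "SWF D f \<longleftrightarrow> f \<in> profiles D \<rightarrow> Prefs"

definition pareto_optimality ::
    "'a::finite pref set \<Rightarrow> (('n::finite \<Rightarrow> 'a pref) \<Rightarrow> 'a pref) \<Rightarrow> bool" where
  "pareto_optimality D f \<longleftrightarrow>
     (\<forall>p\<in>outcomes. \<forall>q\<in>outcomes. \<forall>R\<in>profiles D. (\<forall>i. weakly_pref (R i) p q) \<longrightarrow>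
        weakly_pref (f R) p q \<and> ((\<exists>i. (p, q) \<in> R i) \<longrightarrow> (p, q) \<in> f R))"

definition IIA :: "'a::finite pref set \<Rightarrow> (('n::finite \<Rightarrow> 'a pref) \<Rightarrow> 'a pref) \<Rightarrow> bool" where
  "IIA D f \<longleftrightarrow>
     (\<forall>R\<in>profiles D. \<forall>R'\<in>profiles D. \<forall>X.
        (\<forall>i. Restr (R i) (outcomes_on X) = Restr (R' i) (outcomes_on X)) \<longrightarrow>
        Restr (f R) (outcomes_on X) = Restr (f R') (outcomes_on X))"

definition arrovian :: "'a::finite pref set \<Rightarrow> (('n::finite \<Rightarrow> 'a pref) \<Rightarrow> 'a pref) \<Rightarrow> bool" where
  "arrovian D f \<longleftrightarrow> SWF D f \<and> pareto_optimality D f \<and> IIA D f"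

definition perm_outcome :: "('a::finite \<Rightarrow> 'a) \<Rightarrow> real ^ 'a \<Rightarrow> real ^ 'a" where
  "perm_outcome \<pi> p = (\<chi> a. p $ inv \<pi> a)"

definition perm_pref :: "('a::finite \<Rightarrow> 'a) \<Rightarrow> 'a pref \<Rightarrow> 'a pref" where
  "perm_pref \<pi> P = {(perm_outcome \<pi> p, perm_outcome \<pi> q) | p q. (p, q) \<in> P}"

lemma perm_outcome_apply:
  assumes "bij \<pi>"
  shows "perm_outcome \<pi> p $ \<pi> a = p $ a"
  using assms by (simp add: perm_outcome_def bij_is_inj)

lemma perm_pref_iff:
  assumes "bij \<pi>"
  shows "(perm_outcome \<pi> p, perm_outcome \<pi> q) \<in> perm_pref \<pi> P \<longleftrightarrow> (p, q) \<in> P"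
proof -
  have "perm_outcome \<pi> x = perm_outcome \<pi> y \<longleftrightarrow> x = y" for x y
    by (metis assms perm_outcome_apply vec_eq_iff)
  then show ?thesis
    by (auto simp: perm_pref_def)
qed

text \<open>
  In the last conjunct the restrictions are to the pure outcomes in \<open>X\<close> only, not to all outcomes
  supported in \<open>X\<close>.
\<close>

definition rich :: "'a::finite pref set \<Rightarrow> bool" where
  "rich D \<longleftrightarrow>
     (\<forall>P\<in>Prefs. \<forall>\<pi>. bij \<pi> \<longrightarrow> (P \<in> D \<longleftrightarrow> perm_pref \<pi> P \<in> D)) \<and>
     {} \<in> D \<and>
     (\<forall>P\<in>D. P\<inverse> \<in> D) \<and>
     (\<forall>P'\<in>D. \<forall>X. card X \<le> 4 \<longrightarrow>
        (\<exists>P\<in>D. \<exists>a. Restr P (pure ` X) = Restr P' (pure ` X) \<and>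
           (\<forall>x\<in>X. (pure x, pure a) \<in> P)))"

end

theory Submission
  imports Defs
begin

text \<open>
  Every relation in \<open>Prefs\<close> is represented by a skew-symmetric matrix (Fishburn's theorem). At an
  outcome \<open>p\<close> of full support, continuity and convexity force the upper and lower sets of \<open>p\<close> to be
  the two sides of a hyperplane, the zero set of a linear functional \<open>g\<^sub>p\<close>. The symmetry axiom says that
  along a segment the suitably scaled functional satisfies Jensen's equation locally, so it is
  affine. This yields the cycle condition
  \<open>g\<^sub>p(q) g\<^sub>q(r) g\<^sub>r(p) = - g\<^sub>p(r) g\<^sub>r(q) g\<^sub>q(p)\<close>, which is exactly what is needed to scale the
  functionals into a skew bilinear form on the full-support outcomes; outcomes on the boundary are
  handled by limits.

  For the social matrix, adjoin an alternative \<open>e\<close> which every agent ranks below the given ones. By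
  Pareto optimality all given alternatives beat \<open>e\<close> by the same social margin, which serves as a
  unit: by IIA, the social margin of \<open>b\<close> over \<open>a\<close> in this unit depends only on the vector
  \<open>s\<close> of individual comparisons of \<open>b\<close> with \<open>a\<close>. If \<open>b\<close> is compared with \<open>a\<close> as \<open>a\<close>
  is with \<open>c\<close>, then everybody, hence society, is indifferent between \<open>a\<close> and the
  midpoint of \<open>b\<close> and \<open>c\<close>; this gives neutrality, and a similar argument with the
  centre of three alternatives gives additivity in \<open>s\<close>. Hence the margin is a weighted sum of the
  \<open>s i\<close>. Two outcomes on edges of the simplex involve at most four alternatives, so a fifth one can
  play the role of \<open>e\<close>, and edges determine the signs of a bilinear form.
\<close>

subsection \<open>Mixtures and bilinear forms on the simplex\<close>

lemma mix_comp [simp]: "mix p l q $ a = l * p $ a + (1 - l) * q $ a"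
  by (simp add: mix_def)

lemma inner_mix: "g \<bullet> mix p l q = l * (g \<bullet> p) + (1 - l) * (g \<bullet> q)"
  by (simp add: mix_def inner_add_right)

lemma outcomes_mix:
  assumes "p \<in> outcomes" "q \<in> outcomes" "0 \<le> l" "l \<le> 1"
  shows "mix p l q \<in> outcomes"
  using assms
  by (simp add: outcomes_def sum.distrib sum_distrib_left [symmetric])

lemma pure_outcomes [simp]: "pure a \<in> outcomes"
  by (simp add: outcomes_def pure_def axis_def)

lemma mix_self [simp]: "mix p l p = p"
  by (simp add: mix_def vec_eq_iff algebra_simps)

lemma mix_1 [simp]: "mix p 1 q = p" and mix_0 [simp]: "mix p 0 q = q"
  by (simp_all add: mix_def)

lemma mix_swap: "mix p l q = mix q (1 - l) p"
  by (simp add: mix_def)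

lemma mix_half: "mix p (1/2) q = mix q (1/2) p"
  by (simp add: mix_def)

lemma convex_mixD:
  assumes "convex S" "p \<in> S" "q \<in> S" "0 \<le> l" "l \<le> 1"
  shows "mix p l q \<in> S"
  using assms convexD [of S p q l "1 - l"] by (simp add: mix_def)

lemma tendsto_mix:
  "((\<lambda>t. mix p (1 - t) q) \<longlongrightarrow> p) (at_right 0)"
proof -
  have "((\<lambda>t. (1 - t) *\<^sub>R p + t *\<^sub>R q) \<longlongrightarrow> (1 - 0) *\<^sub>R p + 0 *\<^sub>R q) (at_right 0)"
    by (intro tendsto_intros)
  then show ?thesis
    by (simp add: mix_def)
qed

definition bil :: "('a::finite \<Rightarrow> 'a \<Rightarrow> real) \<Rightarrow> real ^ 'a \<Rightarrow> real ^ 'a \<Rightarrow> real" where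
  "bil M p q = (\<Sum>a\<in>UNIV. \<Sum>b\<in>UNIV. p $ a * q $ b * M a b)"

lemma bil_mix_left: "bil M (mix p l q) r = l * bil M p r + (1 - l) * bil M q r"
  by (simp add: bil_def sum.distrib [symmetric] sum_distrib_left algebra_simps)

lemma bil_mix_right: "bil M r (mix p l q) = l * bil M r p + (1 - l) * bil M r q"
  by (simp add: bil_def sum.distrib [symmetric] sum_distrib_left algebra_simps)

lemma pure_sum [simp]: "(\<Sum>a\<in>UNIV. pure b $ a * F a) = F b"
  by (simp add: pure_def axis_def if_distrib if_distribR cong: if_cong)

lemma bil_sum_left: "bil M p q = (\<Sum>a\<in>UNIV. p $ a * bil M (pure a) q)"
  by (simp add: bil_def mult.assoc sum_distrib_left [symmetric])

lemma bil_sum_right: "bil M p q = (\<Sum>b\<in>UNIV. q $ b * bil M p (pure b))"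
proof -
  have "bil M p (pure b) = (\<Sum>a\<in>UNIV. p $ a * M a b)" for b
    by (simp add: bil_def mult.assoc sum_distrib_left [symmetric])
  then have "(\<Sum>b\<in>UNIV. q $ b * bil M p (pure b)) = (\<Sum>b\<in>UNIV. \<Sum>a\<in>UNIV. p $ a * q $ b * M a b)"
    by (simp add: sum_distrib_left mult_ac)
  also have "\<dots> = bil M p q"
    unfolding bil_def by (rule sum.swap)
  finally show ?thesis ..
qed

lemma bil_pure [simp]: "bil M (pure a) (pure b) = M a b"
  by (simp add: bil_def mult.assoc sum_distrib_left [symmetric])

lemma bil_skew:
  assumes "\<And>a b. M a b = - M b a"
  shows "bil M p q = - bil M q p"
proof -
  have "bil M p q = (\<Sum>a\<in>UNIV. \<Sum>b\<in>UNIV. - (q $ b * p $ a * M b a))"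
    unfolding bil_def
    by (intro sum.cong refl) (subst assms, simp)
  also have "\<dots> = - bil M q p"
    unfolding bil_def by (subst sum.swap) (simp add: sum_negf)
  finally show ?thesis .
qed

section \<open>Outcomes of full support\<close>

definition interior_outcomes :: "(real ^ 'a::finite) set" where
  "interior_outcomes = {p \<in> outcomes. \<forall>a. 0 < p $ a}"

lemma interior_outcomesD: "p \<in> interior_outcomes \<Longrightarrow> p \<in> outcomes"
  by (simp add: interior_outcomes_def)

lemma interior_mix:
  assumes "p \<in> interior_outcomes" "q \<in> outcomes" "0 < l" "l \<le> 1"
  shows "mix p l q \<in> interior_outcomes"
  using assms outcomes_mix [of p q l]
  by (auto simp: interior_outcomes_def outcomes_def intro!: add_pos_nonneg)

lemma interior_move:
  assumes "p \<in> interior_outcomes" "(\<Sum>a\<in>UNIV. d $ a) = 0"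
  shows "\<exists>e>0. p + e *\<^sub>R d \<in> interior_outcomes"
proof -
  have "\<forall>\<^sub>F e in at_right 0. \<forall>a. 0 < p $ a + e * d $ a"
  proof (intro eventually_all_finite)
    fix a
    have "((\<lambda>e. p $ a + e * d $ a) \<longlongrightarrow> p $ a + 0 * d $ a) (at_right 0)"
      by (intro tendsto_intros)
    then show "\<forall>\<^sub>F e in at_right 0. 0 < p $ a + e * d $ a"
      using assms(1) by (intro order_tendstoD(1)) (auto simp: interior_outcomes_def)
  qed
  then have "\<forall>\<^sub>F e in at_right 0. e > 0 \<and> (\<forall>a. 0 < p $ a + e * d $ a)"
    by (intro eventually_conj eventually_at_right_less)
  then obtain e where e: "e > 0" "\<forall>a. 0 < p $ a + e * d $ a"
    using eventually_happens' trivial_limit_at_right_real by blast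
  have "p + e *\<^sub>R d \<in> interior_outcomes"
    using e assms
    by (simp add: interior_outcomes_def outcomes_def less_imp_le sum.distrib sum_distrib_left [symmetric])
  then show ?thesis
    using e by blast
qed

text \<open>The segment from \<open>z\<close> to \<open>p\<close> can be prolonged a little beyond a
  full-support \<open>p\<close>. This turns information on one side of \<open>p\<close> into
  information on the opposite side.\<close>

lemma interior_reflect:
  assumes "p \<in> interior_outcomes" "z \<in> outcomes"
  shows "\<exists>z'\<in>interior_outcomes. \<exists>l. 0 < l \<and> l < 1 \<and> p = mix z l z'"
proof -
  have "(\<Sum>a\<in>UNIV. (p - z) $ a) = 0"
    using assms by (simp add: interior_outcomes_def outcomes_def sum_subtractf)
  then obtain e where e: "e > 0" "p + e *\<^sub>R (p - z) \<in> interior_outcomes"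
    using interior_move assms(1) by blast
  \<comment> \<open>The equation \<open>p = c z + (1 - c) (p + e (p - z))\<close> amounts to
    \<open>(1 - c) * e = c\<close>.\<close>
  define c where "c = e / (1 + e)"
  have c: "0 < c" "c < 1" "(1 - c) * e = c"
    using e(1) by (simp_all add: c_def field_simps)
  have "p $ a = mix z c (p + e *\<^sub>R (p - z)) $ a" for a
  proof -
    have "mix z c (p + e *\<^sub>R (p - z)) $ a = c * z $ a + (1 - c) * p $ a + ((1 - c) * e) * (p $ a - z $ a)"
      by (simp add: algebra_simps)
    then show ?thesis
      unfolding c(3) by (simp add: algebra_simps)
  qed
  then show ?thesis
    using e c by (intro bexI [OF _ e(2)] exI [of _ c]) (auto simp: vec_eq_iff)
qed

lemma interior_nonempty: "\<exists>c::real ^ 'a::finite. c \<in> interior_outcomes"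
  by (rule exI [of _ "\<chi> a. 1 / real CARD('a)"]) (simp add: interior_outcomes_def outcomes_def)

subsection \<open>Linearity of indifference sets\<close>

locale convex_preference =
  fixes P :: "'a::finite pref"
  assumes Prefs: "P \<in> Prefs"
begin

lemma in_outcomes: "(p, q) \<in> P \<Longrightarrow> p \<in> outcomes \<and> q \<in> outcomes"
  using Prefs by (auto simp: Prefs_def preference_def)

lemma asym: "(p, q) \<in> P \<Longrightarrow> (q, p) \<notin> P"
  using Prefs by (auto simp: Prefs_def preference_def asym_on_def)

lemma irrefl [simp]: "(p, p) \<notin> P"
  using asym by blast

lemma indiff_sym: "indiff P p q \<longleftrightarrow> indiff P q p"
  by (auto simp: indiff_def)

lemma lower_mix:
  assumes "(r, p) \<in> P" "(r, q) \<in> P" "0 \<le> l" "l \<le> 1"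
  shows "(r, mix p l q) \<in> P"
proof -
  have "convex (lower P r)"
    using Prefs in_outcomes assms by (auto simp: Prefs_def convex_pref_def)
  then have "mix p l q \<in> lower P r"
    by (rule convex_mixD) (use assms in_outcomes in \<open>auto simp: lower_def\<close>)
  then show ?thesis
    by (simp add: lower_def)
qed

text \<open>By asymmetry, the complement of a lower set within the outcomes is the union of the
  upper set and the indifference set, which is convex by the convexity axiom.\<close>

lemma not_below_mix:
  assumes "(r, p) \<notin> P" "(r, q) \<notin> P" "p \<in> outcomes" "q \<in> outcomes" "0 \<le> l" "l \<le> 1"
  shows "(r, mix p l q) \<notin> P"
proof (cases "r \<in> outcomes")
  case True
  have "convex (upper P r \<union> indiff_set P r)"
    using Prefs True by (auto simp: Prefs_def convex_pref_def)
  then have "mix p l q \<in> upper P r \<union> indiff_set P r"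
    by (rule convex_mixD) (use assms True in \<open>auto simp: upper_def indiff_set_def indiff_def\<close>)
  then show ?thesis
    using asym by (auto simp: upper_def indiff_set_def indiff_def)
qed (use in_outcomes in blast)

lemma not_above_mix:
  assumes "(p, r) \<notin> P" "(q, r) \<notin> P" "p \<in> outcomes" "q \<in> outcomes" "0 \<le> l" "l \<le> 1"
  shows "(mix p l q, r) \<notin> P"
proof (cases "r \<in> outcomes")
  case True
  have "convex (lower P r \<union> indiff_set P r)"
    using Prefs True by (auto simp: Prefs_def convex_pref_def)
  then have "mix p l q \<in> lower P r \<union> indiff_set P r"
    by (rule convex_mixD) (use assms True in \<open>auto simp: lower_def indiff_set_def indiff_def\<close>)
  then show ?thesis
    using asym by (auto simp: lower_def indiff_set_def indiff_def)
qed (use in_outcomes in blast)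

lemma indiff_mix:
  assumes "indiff P r p" "indiff P r q" "0 \<le> l" "l \<le> 1"
  shows "indiff P r (mix p l q)"
  using assms not_above_mix not_below_mix outcomes_mix by (auto simp: indiff_def)

lemma symmetry:
  assumes "p \<in> outcomes" "q \<in> outcomes" "r \<in> outcomes" "0 < l" "l < 1"
    and "indiff P q (mix p (1/2) r)" "indiff P (mix p l r) (mix p (1/2) q)"
  shows "indiff P (mix r l p) (mix r (1/2) q)"
  using Prefs assms by (auto simp: Prefs_def symmetric_pref_def)

lemma upper_open:
  assumes "(p, r) \<in> P"
  shows "\<exists>e>0. \<forall>x\<in>outcomes. dist x p < e \<longrightarrow> (x, r) \<in> P"
proof -
  have "openin (top_of_set outcomes) (upper P r)"
    using Prefs assms in_outcomes by (auto simp: Prefs_def continuous_pref_def)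
  moreover have "p \<in> upper P r"
    using assms in_outcomes by (auto simp: upper_def)
  ultimately show ?thesis
    unfolding openin_euclidean_subtopology_iff by (auto simp: upper_def)
qed

lemma lower_open:
  assumes "(r, p) \<in> P"
  shows "\<exists>e>0. \<forall>x\<in>outcomes. dist x p < e \<longrightarrow> (r, x) \<in> P"
proof -
  have "openin (top_of_set outcomes) (lower P r)"
    using Prefs assms in_outcomes by (auto simp: Prefs_def continuous_pref_def)
  moreover have "p \<in> lower P r"
    using assms in_outcomes by (auto simp: lower_def)
  ultimately show ?thesis
    unfolding openin_euclidean_subtopology_iff by (auto simp: lower_def)
qed

lemma upper_eventually:
  assumes "(p, r) \<in> P" "(x \<longlongrightarrow> p) F" "\<forall>\<^sub>F t in F. x t \<in> outcomes"
  shows "\<forall>\<^sub>F t in F. (x t, r) \<in> P"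
proof -
  obtain e where e: "e > 0" "\<forall>x\<in>outcomes. dist x p < e \<longrightarrow> (x, r) \<in> P"
    using upper_open assms(1) by blast
  show ?thesis
    using tendstoD [OF assms(2) e(1)] assms(3) by eventually_elim (use e in auto)
qed

lemma lower_eventually:
  assumes "(r, p) \<in> P" "(x \<longlongrightarrow> p) F" "\<forall>\<^sub>F t in F. x t \<in> outcomes"
  shows "\<forall>\<^sub>F t in F. (r, x t) \<in> P"
proof -
  obtain e where e: "e > 0" "\<forall>x\<in>outcomes. dist x p < e \<longrightarrow> (r, x) \<in> P"
    using lower_open assms(1) by blast
  show ?thesis
    using tendstoD [OF assms(2) e(1)] assms(3) by eventually_elim (use e in auto)
qed

lemma eventually_mix_outcomes:
  assumes "p \<in> outcomes" "z \<in> outcomes"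
  shows "\<forall>\<^sub>F t in at_right 0. mix p (1 - t) z \<in> outcomes"
proof -
  have "\<forall>\<^sub>F t in at_right (0::real). t \<in> {0<..<1}"
    by (rule eventually_at_right_real) simp
  then show ?thesis
    by eventually_elim (auto intro!: outcomes_mix assms)
qed

text \<open>All axioms are invariant under reversal, so results about lower sets transfer to upper
  sets.\<close>

lemma converse_convex_preference: "convex_preference (P\<inverse>)"
proof
  have 1: "indiff (P\<inverse>) = indiff P"
    by (auto simp: indiff_def fun_eq_iff)
  then have 2: "upper (P\<inverse>) = lower P" "lower (P\<inverse>) = upper P" "indiff_set (P\<inverse>) = indiff_set P"
    by (auto simp: upper_def lower_def indiff_set_def fun_eq_iff)
  show "P\<inverse> \<in> Prefs"
    using Prefs 
    by (auto simp: Prefs_def preference_def asym_on_def continuous_pref_def convex_pref_def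
        symmetric_pref_def 1 2)
qed

text \<open>The symmetry axiom, with \<open>q = r\<close>, excludes thick indifference on a segment.\<close>

lemma above_midpoint:
  assumes "(a, b) \<in> P"
  shows "(a, mix a (1/2) b) \<in> P"
proof (rule ccontr)
  let ?m = "mix a (1/2) b"
  assume "(a, ?m) \<notin> P"
  have ab: "a \<in> outcomes" "b \<in> outcomes"
    using assms in_outcomes by auto
  then have m: "?m \<in> outcomes"
    by (simp add: outcomes_mix)
  have "(?m, a) \<notin> P"
    by (rule not_above_mix) (use assms asym ab in auto)
  with \<open>(a, ?m) \<notin> P\<close> have ind: "indiff P a ?m"
    using ab m by (simp add: indiff_def)
  \<comment> \<open>Points between the midpoint and \<open>b\<close> mirror points between
    \<open>a\<close> and the midpoint, which are all indifferent to the midpoint by convexity. The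
    symmetry axiom then makes points arbitrarily close to \<open>b\<close> indifferent to
    \<open>a\<close>, against openness of the lower set.\<close>
  have *: "(a, mix a l b) \<notin> P" if "0 < l" "l \<le> 1/2" for l
  proof -
    have eq: "mix b l a = mix ?m (2 * l) a"
      by (simp add: vec_eq_iff algebra_simps)
    have "indiff P ?m (mix b l a)"
      unfolding eq by (rule indiff_mix) (use that ind m in \<open>auto simp: indiff_def\<close>)
    then have "indiff P (mix b l a) (mix b (1/2) a)"
      unfolding mix_half [of b a] by (subst indiff_sym)
    moreover have "indiff P a (mix b (1/2) a)"
      unfolding mix_half [of b a] by (rule ind)
    ultimately have "indiff P (mix a l b) (mix a (1/2) a)"
      by (intro symmetry [of b a a l]) (use ab that in auto)
    then show ?thesis
      by (simp add: indiff_def)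
  qed
  have "\<forall>\<^sub>F t in at_right 0. (a, mix b (1 - t) a) \<in> P"
    using assms ab by (intro lower_eventually [OF _ tendsto_mix] eventually_mix_outcomes)
  moreover have "\<forall>\<^sub>F t in at_right (0::real). t \<in> {0<..<1/2}"
    by (rule eventually_at_right_real) simp
  ultimately have "\<forall>\<^sub>F t in at_right (0::real). False"
  proof eventually_elim
    case (elim t)
    then show False
      using * [of t] by (simp add: mix_swap [of a t b])
  qed
  then show False
    by simp
qed

text \<open>Iterated midpoints starting at \<open>b\<close> converge to \<open>a\<close> and all lie
  below \<open>a\<close>; convexity of the lower set covers the points between them and
  \<open>b\<close>.\<close>

lemma above_mix:
  assumes "(a, b) \<in> P" "0 \<le> l" "l < 1"
  shows "(a, mix a l b) \<in> P"
proof -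
  have *: "(a, mix a (1 - (1/2) ^ k) b) \<in> P" for k
  proof (induction k)
    case (Suc k)
    have "mix a (1 - (1/2) ^ Suc k) b = mix a (1/2) (mix a (1 - (1/2) ^ k) b)"
      by (simp add: vec_eq_iff algebra_simps)
    then show ?case
      using above_midpoint [OF Suc] by simp
  qed (use assms in simp)
  obtain k where k: "(1/2) ^ k < 1 - l"
    using real_arch_pow_inv [of "1 - l" "1/2"] assms by auto
  define c where "c = 1 - (1/2::real) ^ k"
  have c: "0 < c" "l \<le> c"
    using k assms unfolding c_def by linarith+
  have "mix a l b = mix (mix a c b) (l / c) b"
    using c by (simp add: vec_eq_iff field_simps)
  moreover have "(a, mix (mix a c b) (l / c) b) \<in> P"
    by (rule lower_mix [OF * [of k, folded c_def] assms(1)]) (use c assms in auto)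
  ultimately show ?thesis
    by simp
qed

lemma mix_above:
  assumes "(a, b) \<in> P" "0 < l" "l \<le> 1"
  shows "(mix a l b, b) \<in> P"
  using convex_preference.above_mix [OF converse_convex_preference, of b a "1 - l"] assms
  by (simp add: mix_swap [of b])

text \<open>If \<open>x\<close> were not above \<open>x'\<close>, convexity would make it not above
  the inner point either. So \<open>mix_above\<close> applies to \<open>x\<close> and
  \<open>x'\<close>.\<close>

lemma between_above:
  assumes "(x, mix x l x') \<in> P" "x' \<in> outcomes" "0 < l" "l < 1"
  shows "(mix x l x', x') \<in> P"
proof -
  have "x \<in> outcomes"
    using assms in_outcomes by blast
  then have "(x, x') \<in> P"
    using not_below_mix [of x x x' l] assms by auto
  then show ?thesis
    using mix_above assms by auto
qed

lemma between_below:
  assumes "(mix x l x', x) \<in> P" "x' \<in> outcomes" "0 < l" "l < 1"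
  shows "(x', mix x l x') \<in> P"
  using convex_preference.between_above [OF converse_convex_preference, of x l x'] assms
  by simp

lemma between_indiff:
  assumes "indiff P (mix x l x') x" "x' \<in> outcomes" "0 < l" "l < 1"
  shows "indiff P (mix x l x') x'"
  using between_above [of x' "1 - l" x] between_below [of x' "1 - l" x] assms
  by (auto simp: mix_swap [of x'] indiff_def)

text \<open>Suppose \<open>p\<close> is indifferent to \<open>s = mix q l r\<close>. Reflecting
  \<open>r\<close> through \<open>p\<close> gives an \<open>r'\<close> indifferent to
  \<open>p\<close>, and the segment from \<open>s\<close> to \<open>r'\<close> meets the segment
  from \<open>p\<close> to \<open>q\<close> away from \<open>p\<close>. The meeting point is
  indifferent to \<open>p\<close> by convexity, but below \<open>p\<close> by
  \<open>above_mix\<close>.\<close>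

lemma dominance:
  assumes "p \<in> interior_outcomes" "(p, q) \<in> P" "indiff P p r" "0 < l" "l \<le> 1"
  shows "(p, mix q l r) \<in> P"
proof (rule ccontr)
  assume neg: "(p, mix q l r) \<notin> P"
  have r: "r \<in> outcomes" and p: "p \<in> outcomes" and q: "q \<in> outcomes"
    using assms in_outcomes by (auto simp: indiff_def)
  have "(mix q l r, p) \<notin> P"
    using not_above_mix [of q p r l] assms asym q r by (auto simp: indiff_def)
  with neg have s: "indiff P p (mix q l r)"
    using p q r assms by (auto simp: indiff_def outcomes_mix)
  obtain r' k where r': "r' \<in> interior_outcomes" "0 < k" "k < 1" "p = mix r k r'"
    using interior_reflect [OF assms(1) r] by blast
  have ir': "indiff P p r'"
    using between_indiff [of r k r'] assms r' interior_outcomesD by auto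
  \<comment> \<open>This weight makes the shares of \<open>r\<close> and \<open>r'\<close>
    proportional to \<open>k\<close> and \<open>1 - k\<close>, so that they combine to a multiple of
    \<open>p\<close>.\<close>
  define c where "c = k / (k + (1 - l) * (1 - k))"
  have den: "0 < k + (1 - l) * (1 - k)"
    using r' assms by (intro add_pos_nonneg) auto
  have "0 \<le> (1 - l) * (1 - k)"
    using r' assms by simp
  then have c: "0 < c" "c \<le> 1"
    using den r' by (simp_all add: c_def)
  have c1: "1 - c = (1 - l) * (1 - k) / (k + (1 - l) * (1 - k))"
    using den by (simp add: c_def field_simps)
  have "mix (mix q l r) c r' = mix p (1 - c * l) q"
  proof -
    have pa: "p $ a = k * r $ a + (1 - k) * r' $ a" for a
      using r'(4) by simp
    have "c * (1 - l) = (1 - c * l) * k" "1 - c = (1 - c * l) * (1 - k)"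
      using den unfolding c1 by (simp_all add: c_def field_simps)
    then show ?thesis
      unfolding vec_eq_iff mix_comp pa
      by (smt (verit) distrib_left mult.assoc mult.commute)
  qed
  moreover have "indiff P p (mix (mix q l r) c r')"
    using indiff_mix s ir' c by auto
  moreover have "(p, mix p (1 - c * l) q) \<in> P"
    using above_mix assms c by (auto simp: mult_le_one)
  ultimately show False
    by (simp add: indiff_def)
qed

end

section \<open>Affinity from a local Jensen equation\<close>

text \<open>A maximum principle: the difference between \<open>D\<close> and its chord vanishes at
  the ends, and Jensen's equation excludes a positive maximum inside; the same holds for the
  negative of the difference. The room \<open>2 * h\<close> around \<open>t\<close> is what the
  derivation of the equation from the symmetry axiom uses.\<close>

lemma locally_Jensen_affine:
  fixes D :: "real \<Rightarrow> real"
  assumes cont: "continuous_on {0<..<1} D"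
    and jensen: "\<And>t h. 0 < h \<Longrightarrow> 0 < t - 2 * h \<Longrightarrow> t + 2 * h < 1 \<Longrightarrow> D (t + h) + D (t - h) = 2 * D t"
    and t: "0 < a" "a < t" "t < b" "b < 1"
  shows "(b - a) * D t = (b - t) * D a + (t - a) * D b"
proof -
  have key: "E t \<le> 0"
    if E: "continuous_on {a..b} E" "E a = 0" "E b = 0"
      "\<And>t h. 0 < h \<Longrightarrow> a < t - 2 * h \<Longrightarrow> t + 2 * h < b \<Longrightarrow> E (t + h) + E (t - h) = 2 * E t"
    for E :: "real \<Rightarrow> real"
  proof (rule ccontr)
    assume "\<not> E t \<le> 0"
    obtain x where x: "x \<in> {a..b}" "\<forall>y\<in>{a..b}. E y \<le> E x"
      using continuous_attains_sup [OF _ _ E(1)] t by auto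
    have pos: "E x > 0"
      using x(2) t \<open>\<not> E t \<le> 0\<close> by (meson atLeastAtMost_iff less_imp_le linorder_not_le order_less_le_trans)
    let ?K = "{a..b} \<inter> E -` {E x}"
    have "closed ?K"
      by (intro continuous_closed_preimage E(1)) auto
    then have "compact ?K"
      using bounded_subset [of "{a..b}" ?K] by (simp add: compact_eq_bounded_closed)
    \<comment> \<open>\<open>z\<close> is the rightmost maximiser. Jensen's equation makes
      \<open>z + h\<close> a maximiser as well, which is absurd.\<close>
    then obtain z where z: "z \<in> ?K" "\<forall>y\<in>?K. y \<le> z"
      using compact_attains_sup [of ?K] x by blast
    have "a < z" "z < b"
      using z(1) pos E by (auto simp: less_le)
    define h where "h = min (z - a) (b - z) / 3"
    have h: "0 < h" "a < z - 2 * h" "z + 2 * h < b"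
      using \<open>a < z\<close> \<open>z < b\<close> by (auto simp: h_def min_def field_simps)
    have "E (z + h) + E (z - h) = 2 * E z"
      using E(4) h by blast
    moreover have "E (z + h) \<le> E x" "E (z - h) \<le> E x"
      using x(2) h by auto
    ultimately have "E (z + h) = E x"
      using z(1) by simp
    moreover have "z + h \<in> {a..b}"
      using h by auto
    ultimately have "z + h \<le> z"
      using z(2) by blast
    then show False
      using h by simp
  qed
  define L where "L = (\<lambda>s. (b - a) * D s - (b - s) * D a - (s - a) * D b)"
  have cL: "continuous_on {a..b} L"
    unfolding L_def by (intro continuous_intros continuous_on_subset [OF cont]) (use t in auto)
  have jL: "L (t + h) + L (t - h) = 2 * L t" if "0 < h" "a < t - 2 * h" "t + 2 * h < b" for t h
  proof -
    have "D (t + h) + D (t - h) = 2 * D t"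
      using that t by (intro jensen) auto
    then have "(b - a) * D (t + h) + (b - a) * D (t - h) = 2 * ((b - a) * D t)"
      by (simp add: distrib_left [symmetric])
    then show ?thesis
      by (simp add: L_def algebra_simps)
  qed
  have "L t \<le> 0"
    by (rule key) (use cL jL in \<open>auto simp: L_def\<close>)
  moreover have "- L t \<le> 0"
  proof (rule key [of "\<lambda>s. - L s"])
    show "- L (t + h) + - L (t - h) = 2 * - L t" if "0 < h" "a < t - 2 * h" "t + 2 * h < b" for t h
      using jL [OF that] by simp
    show "continuous_on {a..b} (\<lambda>s. - L s)"
      by (rule continuous_on_minus [OF cL])
  qed (auto simp: L_def)
  ultimately show ?thesis
    by (simp add: L_def)
qed

section \<open>Supporting functionals at full-support outcomes\<close>

context convex_preference
begin

text \<open>A hyperplane separates the lower from the upper set and passes through \<open>p\<close>.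
  The weak inequalities are then sharpened: openness gives strictness above, reflection through
  \<open>p\<close> gives strictness below, and \<open>dominance\<close> puts indifferent outcomes on
  the hyperplane.\<close>

lemma ex_functional:
  assumes p: "p \<in> interior_outcomes"
  shows "\<exists>g. \<forall>z\<in>outcomes. ((z, p) \<in> P \<longleftrightarrow> 0 < g \<bullet> z) \<and> ((p, z) \<in> P \<longleftrightarrow> g \<bullet> z < 0)"
proof (cases "\<exists>u. (u, p) \<in> P")
  case False
  \<comment> \<open>If nothing is above \<open>p\<close>, reflection through \<open>p\<close> leaves
    nothing below it, and the zero functional works.\<close>
  have "(p, z) \<notin> P" if z: "z \<in> outcomes" for z
  proof
    assume "(p, z) \<in> P"
    moreover obtain z' l where "z' \<in> interior_outcomes" "0 < l" "l < 1" "p = mix z l z'"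
      using interior_reflect [OF p z] by blast
    ultimately have "(z', p) \<in> P"
      using between_below interior_outcomesD by blast
    with False show False
      by blast
  qed
  with False show ?thesis
    by (intro exI [of _ 0]) auto
next
  case True
  then obtain u where u: "(u, p) \<in> P"
    by blast
  obtain u' l where u': "u' \<in> interior_outcomes" "0 < l" "l < 1" "p = mix u l u'"
    using interior_reflect [OF p] u in_outcomes by blast
  have lo: "(p, u') \<in> P"
    using between_above u u' interior_outcomesD by blast
  have pD: "p \<in> outcomes"
    using p interior_outcomesD by blast
  \<comment> \<open>Both sets lie in the hyperplane of coordinate sum 1. Adding the line spanned by
    the all-ones vector keeps them disjoint and forces the separating \<open>g\<close> to be
    orthogonal to that vector, so \<open>g\<close> is not constant on the simplex.\<close>
  have cone: "convex {x + y |x y. x \<in> A \<and> y \<in> span {1}}" if "convex A" for A :: "(real ^ 'a) set"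
  proof -
    have "{x + y |x y. x \<in> A \<and> y \<in> span {1}} = (\<Union>x\<in>A. \<Union>y\<in>span {1}. {x + y})"
      by auto
    then show ?thesis
      using convex_sums [OF that subspace_imp_convex [OF subspace_span [of "{1}"]]] by simp
  qed
  let ?one = "1 :: real ^ 'a"
  let ?S = "{x + y |x y. x \<in> lower P p \<and> y \<in> span {?one}}"
  let ?T = "{x + y |x y. x \<in> upper P p \<and> y \<in> span {?one}}"
  have total: "(\<Sum>a\<in>UNIV. (x + c *\<^sub>R ?one) $ a) = 1 + c * real CARD('a)" if "x \<in> outcomes" for x c
    using that by (simp add: outcomes_def sum.distrib)
  have disj: "?S \<inter> ?T = {}"
  proof (rule equals0I)
    fix z assume "z \<in> ?S \<inter> ?T"
    then obtain x x' y y' where "x \<in> lower P p" "y \<in> upper P p"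
      "z = x + x'" "x' \<in> span {?one}" "z = y + y'" "y' \<in> span {?one}"
      by blast
    then obtain c d where xy: "x \<in> lower P p" "y \<in> upper P p"
      "z = x + c *\<^sub>R ?one" "z = y + d *\<^sub>R ?one"
      unfolding span_singleton by blast
    then have "1 + c * real CARD('a) = 1 + d * real CARD('a)"
      using total [of x c] total [of y d] by (simp add: lower_def upper_def)
    then have "x = y"
      using xy by simp
    then show False
      using xy asym by (auto simp: lower_def upper_def)
  qed
  have conv: "convex ?S" "convex ?T"
    by (intro cone; use Prefs pD in \<open>auto simp: Prefs_def convex_pref_def\<close>)+
  have elts: "x + c *\<^sub>R ?one \<in> ?S" if "(p, x) \<in> P" for x c
    using that in_outcomes by (fastforce simp: lower_def span_singleton)
  have eltt: "x + c *\<^sub>R ?one \<in> ?T" if "(x, p) \<in> P" for x c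
    using that in_outcomes by (fastforce simp: upper_def span_singleton)
  have ne: "?S \<noteq> {}" "?T \<noteq> {}"
    using elts [OF lo, of 0] eltt [OF u, of 0] by blast+
  obtain g b where g: "g \<noteq> 0" "\<forall>x\<in>?S. g \<bullet> x \<le> b" "\<forall>x\<in>?T. b \<le> g \<bullet> x"
    using separating_hyperplane_sets [OF conv ne disj] by (elim exE conjE) (rule that)
  have low: "g \<bullet> x + c * (g \<bullet> ?one) \<le> b" if "(p, x) \<in> P" for x c
    using bspec [OF g(2) elts [OF that, of c]] by (simp only: inner_add_right inner_scaleR_right)
  have upp: "b \<le> g \<bullet> x + c * (g \<bullet> ?one)" if "(x, p) \<in> P" for x c
    using bspec [OF g(3) eltt [OF that, of c]] by (simp only: inner_add_right inner_scaleR_right)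
  have g1: "g \<bullet> ?one = 0"
  proof (rule ccontr)
    assume "g \<bullet> ?one \<noteq> 0"
    then show False
      using low [OF lo, of "(b + 1 - g \<bullet> u') / (g \<bullet> ?one)"] by simp
  qed
  \<comment> \<open>Every outcome has inner product 1 with \<open>?one\<close>, so subtracting
    \<open>b\<close> times \<open>?one\<close> moves the threshold to 0.\<close>
  define f where "f = g - b *\<^sub>R ?one"
  have one: "?one \<bullet> z = 1" if "z \<in> outcomes" for z
    using that by (simp add: inner_vec_def outcomes_def)
  have f: "f \<bullet> z = g \<bullet> z - b" if "z \<in> outcomes" for z
    using one [OF that] by (simp add: f_def inner_diff_left)
  have low': "f \<bullet> z \<le> 0" if "(p, z) \<in> P" for z
    using low [OF that, of 0] f in_outcomes [OF that] by simp
  have upp': "0 \<le> f \<bullet> z" if "(z, p) \<in> P" for z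
    using upp [OF that, of 0] f in_outcomes [OF that] by simp
  have near: "\<forall>\<^sub>F t in at_right (0::real). t \<in> {0<..<1}"
    by (rule eventually_at_right_real) simp
  have lim: "((\<lambda>t. f \<bullet> mix x (1 - t) y) \<longlongrightarrow> f \<bullet> x) (at_right 0)" for x y
    by (intro tendsto_intros tendsto_mix)
  have fp: "f \<bullet> p = 0"
  proof -
    have "\<forall>\<^sub>F t in at_right (0::real). f \<bullet> mix p (1 - t) u' \<le> 0"
      using near
    proof eventually_elim
      case (elim t)
      then show ?case
        by (intro low' above_mix [OF lo]) auto
    qed
    then have "f \<bullet> p \<le> 0"
      by (intro tendsto_upperbound [OF lim]) auto
    moreover have "\<forall>\<^sub>F t in at_right (0::real). 0 \<le> f \<bullet> mix p (1 - t) u"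
      using near
    proof eventually_elim
      case (elim t)
      then show ?case
        using mix_above [OF u, of t] by (intro upp') (simp add: mix_swap [of p _ u])
    qed
    then have "0 \<le> f \<bullet> p"
      by (intro tendsto_lowerbound [OF lim]) auto
    ultimately show ?thesis
      by simp
  qed
  \<comment> \<open>Since \<open>g\<close> is orthogonal to the all-ones vector, \<open>- g\<close>
    is a direction tangent to the simplex along which \<open>g\<close> decreases.\<close>
  have "\<exists>d. g \<bullet> d < 0 \<and> (\<Sum>a\<in>UNIV. d $ a) = 0"
  proof (intro exI [of _ "- g"] conjI)
    show "g \<bullet> - g < 0"
      using g(1) by simp
    show "(\<Sum>a\<in>UNIV. (- g) $ a) = 0"
      using g1 by (simp add: inner_vec_def sum_negf)
  qed
  then obtain d where d: "g \<bullet> d < 0" "(\<Sum>a\<in>UNIV. d $ a) = 0"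
    by blast
  have fd: "f \<bullet> d = g \<bullet> d"
  proof -
    have "?one \<bullet> d = 0"
      using d(2) by (simp add: inner_vec_def)
    then show ?thesis
      by (simp add: f_def inner_diff_left)
  qed
  have strict_up: "0 < f \<bullet> z" if z: "(z, p) \<in> P" for z
  proof (rule ccontr)
    assume "\<not> 0 < f \<bullet> z"
    with upp' [OF z] have fz: "f \<bullet> z = 0"
      by simp
    \<comment> \<open>The midpoint with \<open>p\<close> has full support, so it can be moved along
      \<open>d\<close>. A small move makes \<open>f\<close> negative while openness keeps the point
      above \<open>p\<close>.\<close>
    let ?m = "mix p (1/2) z"
    have m: "(?m, p) \<in> P"
      using mix_above [OF z, of "1/2"] by (simp add: mix_half [of p])
    have mi: "?m \<in> interior_outcomes"
      by (rule interior_mix) (use p z in_outcomes in auto)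
    obtain e where e: "e > 0" "?m + e *\<^sub>R d \<in> interior_outcomes"
      using interior_move [OF mi d(2)] by blast
    have "\<forall>\<^sub>F t in at_right 0. (mix ?m (1 - t) (?m + e *\<^sub>R d), p) \<in> P"
      using e in_outcomes [OF m] interior_outcomesD
      by (intro upper_eventually [OF m tendsto_mix] eventually_mix_outcomes) auto
    then have "\<forall>\<^sub>F t in at_right (0::real). False"
      using near
    proof eventually_elim
      case (elim t)
      then have "0 \<le> f \<bullet> mix ?m (1 - t) (?m + e *\<^sub>R d)"
        using upp' by blast
      also have "\<dots> = t * (e * (g \<bullet> d))"
        by (simp add: inner_mix inner_add_right fp fz fd)
      also have "\<dots> < 0"
        using elim e d by (simp add: mult_pos_neg)
      finally show False
        by simp
    qed
    then show False
      by simp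
  qed
  have strict_low: "f \<bullet> z < 0" if z: "(p, z) \<in> P" for z
  proof -
    obtain z' l where z': "z' \<in> interior_outcomes" "0 < l" "l < 1" "p = mix z l z'"
      using interior_reflect [OF p] z in_outcomes by blast
    have "(z', p) \<in> P"
      using between_below z z' interior_outcomesD by blast
    then have "0 < f \<bullet> z'"
      by (rule strict_up)
    moreover have "0 = l * (f \<bullet> z) + (1 - l) * (f \<bullet> z')"
      using fp z'(4) inner_mix by metis
    ultimately show ?thesis
      using z' by (smt (verit) mult_nonneg_nonneg mult_pos_pos)
  qed
  \<comment> \<open>By \<open>dominance\<close>, mixing \<open>z\<close> with \<open>u'\<close> or
    \<open>u\<close> gives points strictly below or above \<open>p\<close>; letting the mixtures
    tend to \<open>z\<close> bounds \<open>f\<close> from both sides.\<close>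
  have indif: "f \<bullet> z = 0" if z: "indiff P p z" for z
  proof -
    have "f \<bullet> z \<le> 0"
    proof -
      have "\<forall>\<^sub>F t in at_right (0::real). f \<bullet> mix z (1 - t) u' \<le> 0"
        using near
      proof eventually_elim
        case (elim t)
        then have "(p, mix u' t z) \<in> P"
          by (intro dominance [OF p lo z]) auto
        then show ?case
          using low' by (simp add: mix_swap [of z])
      qed
      then show ?thesis
        by (intro tendsto_upperbound [OF lim]) auto
    qed
    moreover have "0 \<le> f \<bullet> z"
    proof -
      have "\<forall>\<^sub>F t in at_right (0::real). 0 \<le> f \<bullet> mix z (1 - t) u"
        using near
      proof eventually_elim
        case (elim t)
        then have "(mix u t z, p) \<in> P"
          using convex_preference.dominance [OF converse_convex_preference p, of u z t] u z
          by (auto simp: indiff_def)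
        then show ?case
          using upp' by (simp add: mix_swap [of z])
      qed
      then show ?thesis
        by (intro tendsto_lowerbound [OF lim]) auto
    qed
    ultimately show ?thesis
      by simp
  qed
  have "((z, p) \<in> P \<longleftrightarrow> 0 < f \<bullet> z) \<and> ((p, z) \<in> P \<longleftrightarrow> f \<bullet> z < 0)" if "z \<in> outcomes" for z
    using strict_up [of z] strict_low [of z] indif [of z] that pD unfolding indiff_def by linarith
  then show ?thesis
    by blast
qed

text \<open>Positive values mean better than \<open>p\<close>. The positive scale at each
  \<open>p\<close> is arbitrary; compatible scales are only chosen in
  \<open>SSB_matrix\<close>.\<close>

definition functional :: "real ^ 'a \<Rightarrow> real ^ 'a" where
  "functional p = (SOME g. \<forall>z\<in>outcomes. ((z, p) \<in> P \<longleftrightarrow> 0 < g \<bullet> z) \<and> ((p, z) \<in> P \<longleftrightarrow> g \<bullet> z < 0))"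

lemma functional:
  assumes "p \<in> interior_outcomes" "z \<in> outcomes"
  shows "(z, p) \<in> P \<longleftrightarrow> 0 < functional p \<bullet> z" "(p, z) \<in> P \<longleftrightarrow> functional p \<bullet> z < 0"
  using someI_ex [OF ex_functional [OF assms(1)]] assms(2) unfolding functional_def by blast+

lemma functional_indiff:
  assumes "p \<in> interior_outcomes" "z \<in> outcomes"
  shows "indiff P p z \<longleftrightarrow> functional p \<bullet> z = 0"
  using functional [OF assms] assms interior_outcomesD by (auto simp: indiff_def)

lemma functional_self [simp]: "p \<in> interior_outcomes \<Longrightarrow> functional p \<bullet> p = 0"
  using functional_indiff [of p p] interior_outcomesD by (auto simp: indiff_def)

lemma functional_commute:
  assumes "p \<in> interior_outcomes" "q \<in> interior_outcomes"
  shows "functional p \<bullet> q > 0 \<longleftrightarrow> functional q \<bullet> p < 0"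
    "functional p \<bullet> q < 0 \<longleftrightarrow> functional q \<bullet> p > 0"
    "functional p \<bullet> q = 0 \<longleftrightarrow> functional q \<bullet> p = 0"
  using functional [of p q] functional [of q p] assms interior_outcomesD
  by (smt (verit, best))+

section \<open>Functionals along a segment and the cycle condition\<close>

text \<open>Dividing by the difference of the endpoint values fixes the scale along the segment.
  Then \<open>h t \<bullet> q\<close> is continuous in \<open>t\<close> by the continuity axiom and
  satisfies Jensen's equation locally by the symmetry axiom.\<close>

lemma segment_functional_affine:
  fixes p r q :: "real ^ 'a"
  defines "x \<equiv> \<lambda>t. mix p (1 - t) r"
  defines "h \<equiv> \<lambda>t. functional (x t) /\<^sub>R (functional (x t) \<bullet> p - functional (x t) \<bullet> r)"
  assumes pr: "(p, r) \<in> P" and int: "\<And>t. 0 < t \<Longrightarrow> t < 1 \<Longrightarrow> x t \<in> interior_outcomes"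
    and q: "q \<in> outcomes"
    and t: "0 < a" "a < t" "t < b" "b < 1"
  shows "(b - a) * (h t \<bullet> q) = (b - t) * (h a \<bullet> q) + (t - a) * (h b \<bullet> q)"
proof (rule locally_Jensen_affine [OF _ _ t])
  have D: "p \<in> outcomes" "r \<in> outcomes"
    using pr in_outcomes by auto
  have xD: "x t \<in> outcomes" if "0 \<le> t" "t \<le> 1" for t
    unfolding x_def by (intro outcomes_mix D) (use that in auto)
  have den: "functional (x t) \<bullet> p - functional (x t) \<bullet> r > 0" if t: "0 < t" "t < 1" for t
  proof -
    have "(p, x t) \<in> P" "(x t, r) \<in> P"
      unfolding x_def using above_mix [OF pr, of "1 - t"] mix_above [OF pr, of "1 - t"] t by auto
    then show ?thesis
      using functional [OF int [OF t]] D by (smt (verit))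
  qed
  have sign: "(z, x t) \<in> P \<longleftrightarrow> 0 < h t \<bullet> z" "(x t, z) \<in> P \<longleftrightarrow> h t \<bullet> z < 0" "indiff P (x t) z \<longleftrightarrow> h t \<bullet> z = 0"
    if "0 < t" "t < 1" "z \<in> outcomes" for t z
    using den [of t] functional [OF int, of t z] functional_indiff [OF int, of t z] that
    by (auto simp: h_def divide_simps mult_less_0_iff zero_less_mult_iff)
  \<comment> \<open>Two equations determine the endpoint values: their difference is 1, and
    \<open>h t\<close> vanishes at \<open>x t\<close>.\<close>
  have ends: "h t \<bullet> p = t" "h t \<bullet> r = t - 1" if t: "0 < t" "t < 1" for t
  proof -
    have "h t \<bullet> p - h t \<bullet> r = 1"
      using den [OF t] by (simp add: h_def divide_inverse_commute [symmetric] diff_divide_distrib [symmetric])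
    moreover have "(1 - t) * (h t \<bullet> p) + t * (h t \<bullet> r) = 0"
      using sign(3) [of t "x t"] t xD inner_mix [of "h t" p "1 - t" r] by (auto simp: x_def indiff_def)
    ultimately show "h t \<bullet> p = t" "h t \<bullet> r = t - 1"
      by (simp_all add: algebra_simps)
  qed
  have hx: "h t \<bullet> x s = t - s" if "0 < t" "t < 1" for t s
    unfolding x_def inner_mix using ends [OF that] by (simp only: x_def) (simp add: algebra_simps)
  have xlim: "(x \<longlongrightarrow> x t) (at t)" for t
    unfolding x_def mix_def by (intro tendsto_intros)
  have near: "\<forall>\<^sub>F s in at t. 0 < s \<and> s < 1" if "0 < t" "t < 1" for t :: real
    using that order_tendstoD(1) [OF tendsto_ident_at, of 0 t UNIV]
      order_tendstoD(2) [OF tendsto_ident_at, of t 1 UNIV] by (intro eventually_conj)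
  have nearD: "\<forall>\<^sub>F s in at t. x s \<in> outcomes" if "0 < t" "t < 1" for t
    using near [OF that] by eventually_elim (auto intro: xD)
  show "continuous_on {0<..<1} (\<lambda>t. h t \<bullet> q)"
  proof (rule continuous_at_imp_continuous_on, rule ballI)
    fix t0 :: real assume "t0 \<in> {0<..<1}"
    then have t0: "0 < t0" "t0 < 1"
      by auto
    \<comment> \<open>Values are read off preferences by mixing \<open>q\<close> with a point
      \<open>x s\<close>: if \<open>\<beta> * (s - t0) = c\<close>, comparing the mixture with
      \<open>x t0\<close> amounts to comparing \<open>h t0 \<bullet> q\<close> with
      \<open>c\<close>.\<close>
    have thresh: "\<exists>\<beta>>0. \<exists>s. 0 < s \<and> s < 1 \<and> \<beta> * (s - t0) = c" for c
    proof -
      have "\<forall>\<^sub>F e in at_right 0. 0 < t0 + e * c" "\<forall>\<^sub>F e in at_right 0. t0 + e * c < 1"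
        using t0 by (auto intro!: order_tendstoD tendsto_eq_intros)
      moreover have "\<forall>\<^sub>F e in at_right (0::real). 0 < e"
        by (rule eventually_at_right_less)
      ultimately have "\<forall>\<^sub>F e in at_right (0::real). 0 < e \<and> 0 < t0 + e * c \<and> t0 + e * c < 1"
        by eventually_elim auto
      then obtain e where "0 < e" "0 < t0 + e * c" "t0 + e * c < 1"
        using eventually_happens' trivial_limit_at_right_real by blast
      then show ?thesis
        by (intro exI [of _ "1 / e"] conjI exI [of _ "t0 + e * c"]) auto
    qed
    have hz: "h t \<bullet> mix (x s) (\<beta> / (1 + \<beta>)) q = (h t \<bullet> q + \<beta> * (t - s)) / (1 + \<beta>)"
      if "0 < \<beta>" "0 < t" "t < 1" for \<beta> t s
    proof -
      have "1 - \<beta> / (1 + \<beta>) = 1 / (1 + \<beta>)"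
        using that by (simp add: field_simps)
      then show ?thesis
        using that by (simp add: inner_mix hx add_divide_distrib)
    qed
    have zD: "mix (x s) (\<beta> / (1 + \<beta>)) q \<in> outcomes" if "0 < \<beta>" "0 < s" "s < 1" for \<beta> s
      using that by (intro outcomes_mix q xD) auto
    show "isCont (\<lambda>t. h t \<bullet> q) t0"
      unfolding isCont_def
    proof (rule order_tendstoI)
      fix c assume "c < h t0 \<bullet> q"
      \<comment> \<open>The gap between \<open>c\<close> and \<open>c'\<close> absorbs the drift
        \<open>\<beta> * (t0 - t)\<close> that arises when \<open>t0\<close> is replaced by a nearby
        \<open>t\<close>.\<close>
      define c' where "c' = (c + h t0 \<bullet> q) / 2"
      have c': "c < c'" "c' < h t0 \<bullet> q"
        using \<open>c < h t0 \<bullet> q\<close> by (auto simp: c'_def)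
      obtain \<beta> s where bs: "0 < \<beta>" "0 < s" "s < 1" "\<beta> * (s - t0) = c'"
        using thresh by blast
      let ?z = "mix (x s) (\<beta> / (1 + \<beta>)) q"
      have "(?z, x t0) \<in> P"
        unfolding sign(1) [OF t0 zD [OF bs(1-3)]] hz [OF bs(1) t0]
        using bs c' by (simp add: right_diff_distrib)
      then have "\<forall>\<^sub>F t in at t0. (?z, x t) \<in> P"
        by (rule lower_eventually [OF _ xlim nearD [OF t0]])
      moreover have "\<forall>\<^sub>F t in at t0. c < c' + \<beta> * (t0 - t)"
        using c' by (intro order_tendstoD(1)) (auto intro!: tendsto_eq_intros)
      ultimately show "\<forall>\<^sub>F t in at t0. c < h t \<bullet> q"
        using near [OF t0]
      proof eventually_elim
        case (elim t)
        then have "0 < (h t \<bullet> q + \<beta> * (t - s)) / (1 + \<beta>)"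
          using sign(1) [of t ?z] zD [OF bs(1-3)] hz [OF bs(1), of t s] by auto
        then show ?case
          using elim bs by (simp add: zero_less_divide_iff algebra_simps)
      qed
    next
      fix c assume "c > h t0 \<bullet> q"
      define c' where "c' = (c + h t0 \<bullet> q) / 2"
      have c': "c > c'" "c' > h t0 \<bullet> q"
        using \<open>c > h t0 \<bullet> q\<close> by (auto simp: c'_def)
      obtain \<beta> s where bs: "0 < \<beta>" "0 < s" "s < 1" "\<beta> * (s - t0) = c'"
        using thresh by blast
      let ?z = "mix (x s) (\<beta> / (1 + \<beta>)) q"
      have "(x t0, ?z) \<in> P"
        unfolding sign(2) [OF t0 zD [OF bs(1-3)]] hz [OF bs(1) t0]
        using bs c' by (simp add: right_diff_distrib divide_less_0_iff)
      then have "\<forall>\<^sub>F t in at t0. (x t, ?z) \<in> P"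
        by (rule upper_eventually [OF _ xlim nearD [OF t0]])
      moreover have "\<forall>\<^sub>F t in at t0. c > c' + \<beta> * (t0 - t)"
        using c' by (intro order_tendstoD(2)) (auto intro!: tendsto_eq_intros)
      ultimately show "\<forall>\<^sub>F t in at t0. c > h t \<bullet> q"
        using near [OF t0]
      proof eventually_elim
        case (elim t)
        then have "0 > (h t \<bullet> q + \<beta> * (t - s)) / (1 + \<beta>)"
          using sign(2) [of t ?z] zD [OF bs(1-3)] hz [OF bs(1), of t s] by auto
        then show ?case
          using elim bs by (simp add: divide_less_0_iff algebra_simps)
      qed
    qed
  qed
  fix t0 k :: real assume k: "0 < k" "0 < t0 - 2 * k" "t0 + 2 * k < 1"
  define \<gamma> where "\<gamma> = (\<lambda>t. h t \<bullet> q)"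
  define s where "s = (\<lambda>y. t0 + y * \<gamma> t0 / (1 - y))"
  \<comment> \<open>For small \<open>y\<close>, the point \<open>mix q y (x (s y))\<close> is indifferent to \<open>x t0\<close>, and \<open>H y\<close> is such that its
    midpoint with \<open>x (t0 - H y)\<close> is indifferent to \<open>x (t0 - k)\<close>.\<close>
  define H where "H = (\<lambda>y. (2 - y) * k + y * (\<gamma> t0 - \<gamma> (t0 - k)))"
  have slim: "(s \<longlongrightarrow> t0) (at_right 0)" and Hlim: "(H \<longlongrightarrow> 2 * k) (at_right 0)"
    unfolding s_def H_def by (auto intro!: tendsto_eq_intros)
  have "\<forall>\<^sub>F y in at_right (0::real). y \<in> {0<..<1}"
    by (rule eventually_at_right_real) simp
  then have "\<forall>\<^sub>F y in at_right (0::real). y \<in> {0<..<1} \<and> 0 < s y \<and> s y < 1 \<and> k < H y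
      \<and> H y < t0 \<and> H y < 1 - t0"
    using k by (intro eventually_conj order_tendstoD [OF slim] order_tendstoD [OF Hlim]) auto
  then have "\<exists>y. y \<in> {0<..<1} \<and> 0 < s y \<and> s y < 1 \<and> k < H y \<and> H y < t0 \<and> H y < 1 - t0"
    by (rule eventually_happens' [OF trivial_limit_at_right_real])
  then obtain y where y: "0 < y" "y < 1" "0 < s y" "s y < 1" "k < H y" "H y < t0" "H y < 1 - t0"
    unfolding greaterThanLessThan_iff by blast
  let ?q = "mix q y (x (s y))" and ?p = "x (t0 - H y)" and ?r = "x (t0 + H y)"
  have hq: "h t \<bullet> ?q = y * \<gamma> t + (1 - y) * (t - t0) - y * \<gamma> t0" if "0 < t" "t < 1" for t
    using y that by (simp add: inner_mix hx \<gamma>_def s_def field_simps)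
  have qD: "?q \<in> outcomes" and pD: "?p \<in> outcomes" and rD: "?r \<in> outcomes"
    using y k by (auto intro!: outcomes_mix q xD)
  \<comment> \<open>This weight yields \<open>x (t0 - k)\<close> on the segment from
    \<open>?p\<close> to \<open>?r\<close> and, with the ends exchanged,
    \<open>x (t0 + k)\<close>.\<close>
  let ?l = "(1 + k / H y) / 2"
  have mids: "mix ?p (1/2) ?r = x t0" "mix ?p ?l ?r = x (t0 - k)" "mix ?r ?l ?p = x (t0 + k)"
    using y k by (simp_all add: x_def vec_eq_iff field_simps)
  have i1: "indiff P ?q (mix ?p (1/2) ?r)"
    unfolding mids indiff_sym [of ?q] using sign(3) [of t0 ?q] qD hq [of t0] k by simp
  have "h (t0 - k) \<bullet> mix ?p (1/2) ?q = 0"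
    using k hq [of "t0 - k"] hx [of "t0 - k" "t0 - H y"]
    by (simp add: inner_mix H_def algebra_simps)
  then have i2: "indiff P (mix ?p ?l ?r) (mix ?p (1/2) ?q)"
    unfolding mids using sign(3) [of "t0 - k" "mix ?p (1/2) ?q"] k pD qD by (simp add: outcomes_mix)
  \<comment> \<open>The symmetry axiom transfers the midpoint condition from \<open>t0 - k\<close>
    to \<open>t0 + k\<close>; eliminating \<open>H y\<close> from the two conditions leaves Jensen's
    equation for \<open>\<gamma>\<close>.\<close>
  have "indiff P (mix ?r ?l ?p) (mix ?r (1/2) ?q)"
    by (rule symmetry [OF pD qD rD _ _ i1 i2]) (use y k in \<open>auto simp: add_pos_pos\<close>)
  then have "h (t0 + k) \<bullet> mix ?r (1/2) ?q = 0"
    unfolding mids using sign(3) [of "t0 + k" "mix ?r (1/2) ?q"] k rD qD by (simp add: outcomes_mix)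
  then have "y * (\<gamma> (t0 + k) + \<gamma> (t0 - k)) = y * (2 * \<gamma> t0)"
    using k hq [of "t0 + k"] hx [of "t0 + k" "t0 + H y"]
    by (simp add: inner_mix H_def algebra_simps)
  then show "h (t0 + k) \<bullet> q + h (t0 - k) \<bullet> q = 2 * (h t0 \<bullet> q)"
    using y by (simp add: \<gamma>_def)
qed

text \<open>The normalised functionals are affine along the segment, so a zero at the parameter
  \<open>t\<close> relates the values at the two ends. The normalising factors there are, up to
  sign, proportional to \<open>functional p \<bullet> r\<close> and
  \<open>functional r \<bullet> p\<close>.\<close>

lemma functional_segment_zero:
  assumes p: "p \<in> interior_outcomes" and r: "r \<in> interior_outcomes" and q: "q \<in> outcomes"
    and ne: "\<not> indiff P p r" and t: "0 < t" "t < 1"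
    and zero: "functional (mix p (1 - t) r) \<bullet> q = 0"
  shows "(1 - t) * (functional p \<bullet> q) * (functional r \<bullet> p) = t * (functional r \<bullet> q) * (functional p \<bullet> r)"
proof -
  have main: "(1 - t) * (functional p \<bullet> q) * (functional r \<bullet> p) = t * (functional r \<bullet> q) * (functional p \<bullet> r)"
    if p: "p \<in> interior_outcomes" and r: "r \<in> interior_outcomes" and pr: "(p, r) \<in> P"
      and t: "0 < t" "t < 1" and zero: "functional (mix p (1 - t) r) \<bullet> q = 0" for p r t
  proof -
    have D: "p \<in> outcomes" "r \<in> outcomes"
      using p r interior_outcomesD by auto
    \<comment> \<open>\<open>segment_functional_affine\<close> speaks of inner parameters only.
      Prolonging the segment to \<open>p'\<close> and \<open>r'\<close> makes \<open>p\<close> and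
      \<open>r\<close> inner points, with parameters \<open>t1\<close> and
      \<open>t2\<close>.\<close>
    have "(\<Sum>a\<in>UNIV. (p - r) $ a) = 0" "(\<Sum>a\<in>UNIV. (r - p) $ a) = 0"
      using D by (simp_all add: outcomes_def sum_subtractf)
    then obtain c d where c: "c > 0" "p + c *\<^sub>R (p - r) \<in> interior_outcomes"
      and d: "d > 0" "r + d *\<^sub>R (r - p) \<in> interior_outcomes"
      using interior_move p r by meson
    define p' where "p' = p + c *\<^sub>R (p - r)"
    define r' where "r' = r + d *\<^sub>R (r - p)"
    note int' = c(2) [folded p'_def] d(2) [folded r'_def]
    have D': "p' \<in> outcomes" "r' \<in> outcomes"
      using int' interior_outcomesD by auto
    define t1 where "t1 = c / (1 + c + d)"
    define t2 where "t2 = (1 + c) / (1 + c + d)"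
    have t12: "0 < t1" "t1 < t2" "t2 < 1"
      using c d by (auto simp: t1_def t2_def field_simps)
    have "t1 * (1 + c + d) = c" "t2 * (1 + c + d) = 1 + c"
      using c d by (simp_all add: t1_def t2_def)
    moreover have "mix p' (1 - s) r' $ i = p $ i + (c - s * (1 + c + d)) * (p $ i - r $ i)" for s i
      by (simp add: p'_def r'_def algebra_simps)
    ultimately have peq: "p = mix p' (1 - t1) r'" and req: "r = mix p' (1 - t2) r'"
      by (simp_all only: vec_eq_iff) simp_all
    have pp: "p = mix p' (1 / (1 + c)) r"
    proof -
      have "mix p' s r $ i = p $ i + (s * (1 + c) - 1) * (p $ i - r $ i)" for s i
        by (simp add: p'_def algebra_simps)
      then show ?thesis
        using c by (simp only: vec_eq_iff) simp
    qed
    have "(p', r) \<in> P"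
      using not_above_mix [of p' r r "1 / (1 + c)"] pp pr D D' c by auto
    moreover have "r = mix p' (d / (1 + c + d)) r'"
      using c d req by (simp add: t2_def field_simps)
    ultimately have pr': "(p', r') \<in> P"
      using not_below_mix [of p' p' r' "d / (1 + c + d)"] D' c d by (auto simp: field_simps)
    define x where "x = (\<lambda>t. mix p' (1 - t) r')"
    define h where "h = (\<lambda>t. functional (x t) /\<^sub>R (functional (x t) \<bullet> p' - functional (x t) \<bullet> r'))"
    define t3 where "t3 = (1 - t) * t1 + t * t2"
    have t3eq: "t3 - t1 = t * (t2 - t1)" "t2 - t3 = (1 - t) * (t2 - t1)"
      by (simp_all add: t3_def algebra_simps)
    then have t3: "t1 < t3" "t3 < t2"
      using t t12 by (smt (verit) mult_pos_pos)+
    have x3: "mix p (1 - t) r = x t3"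
      unfolding x_def t3_def by (subst peq, subst req) (simp add: vec_eq_iff algebra_simps)
    have x1: "x t1 = p" and x2: "x t2 = r"
      using peq req by (simp_all add: x_def)
    have aff: "(t2 - t1) * (h t3 \<bullet> q) = (t2 - t3) * (h t1 \<bullet> q) + (t3 - t1) * (h t2 \<bullet> q)"
      unfolding h_def x_def
    proof (rule segment_functional_affine [OF pr' _ q t12(1) t3 t12(3)])
      show "mix p' (1 - s) r' \<in> interior_outcomes" if "0 < s" "s < 1" for s
        using that by (intro interior_mix int' D') auto
    qed
    have h3: "h t3 \<bullet> q = 0"
      using zero by (simp add: h_def x3)
    have "(t2 - t1) * ((1 - t) * (h t1 \<bullet> q) + t * (h t2 \<bullet> q)) = 0"
      using aff unfolding t3eq h3 by (simp add: algebra_simps)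
    then have lin: "(1 - t) * (h t1 \<bullet> q) + t * (h t2 \<bullet> q) = 0"
      using t12 by simp
    define n1 where "n1 = functional p \<bullet> p' - functional p \<bullet> r'"
    define n2 where "n2 = functional r \<bullet> p' - functional r \<bullet> r'"
    have comp: "p $ i = (1 - t1) * p' $ i + t1 * r' $ i" "r $ i = (1 - t2) * p' $ i + t2 * r' $ i" for i
      by (subst peq, simp) (subst req, simp)
    have "r = p + (t1 - t2) *\<^sub>R (p' - r')" "p = r + (t2 - t1) *\<^sub>R (p' - r')"
      by (simp_all add: vec_eq_iff comp algebra_simps)
    then have "functional p \<bullet> r = functional p \<bullet> p + (t1 - t2) * n1"
      "functional r \<bullet> p = functional r \<bullet> r + (t2 - t1) * n2"
      unfolding n1_def n2_def by (metis inner_add_right inner_diff_right inner_scaleR_right)+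
    then have n: "functional p \<bullet> r = - ((t2 - t1) * n1)" "functional r \<bullet> p = (t2 - t1) * n2"
      using p r by (simp_all add: algebra_simps)
    have "functional p \<bullet> r < 0" "functional r \<bullet> p > 0"
      using functional(2) [OF p D(2)] functional(1) [OF r D(1)] pr by auto
    then have "n1 \<noteq> 0" "n2 \<noteq> 0"
      using n by auto
    moreover have "h t1 \<bullet> q = (functional p \<bullet> q) / n1" "h t2 \<bullet> q = (functional r \<bullet> q) / n2"
      by (simp_all add: h_def x1 x2 n1_def n2_def divide_inverse_commute)
    ultimately have val: "functional p \<bullet> q = n1 * (h t1 \<bullet> q)" "functional r \<bullet> q = n2 * (h t2 \<bullet> q)"
      by simp_all
    have "(1 - t) * (functional p \<bullet> q) * n2 + t * (functional r \<bullet> q) * n1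
        = n1 * n2 * ((1 - t) * (h t1 \<bullet> q) + t * (h t2 \<bullet> q))"
      unfolding val by (simp add: algebra_simps)
    then have "(1 - t) * (functional p \<bullet> q) * n2 = - (t * (functional r \<bullet> q) * n1)"
      unfolding lin by simp
    then have "(t2 - t1) * ((1 - t) * (functional p \<bullet> q) * n2) = (t2 - t1) * - (t * (functional r \<bullet> q) * n1)"
      by simp
    then show ?thesis
      unfolding n by (simp add: algebra_simps)
  qed
  consider "(p, r) \<in> P" | "(r, p) \<in> P"
    using ne p r interior_outcomesD by (auto simp: indiff_def)
  then show ?thesis
  proof cases
    case 1
    then show ?thesis
      using main p r t zero by blast
  next
    case 2
    then show ?thesis
      using main [of r p "1 - t"] p r t zero by (simp add: mix_swap [of r])
  qed
qed

text \<open>If \<open>p\<close>, \<open>q\<close>, \<open>r\<close> form a chain of strict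
  preferences, some inner point of the segment from \<open>p\<close> to \<open>r\<close> is
  indifferent to \<open>q\<close>. Eliminating the parameter of this point from
  \<open>functional_segment_zero\<close> gives the identity.\<close>

lemma cycle:
  assumes int: "p \<in> interior_outcomes" "q \<in> interior_outcomes" "r \<in> interior_outcomes"
    and ne: "\<not> indiff P p q" "\<not> indiff P q r" "\<not> indiff P p r"
  shows "(functional p \<bullet> q) * (functional q \<bullet> r) * (functional r \<bullet> p)
    = - ((functional p \<bullet> r) * (functional r \<bullet> q) * (functional q \<bullet> p))"
proof -
  have main: "(functional p \<bullet> q) * (functional q \<bullet> r) * (functional r \<bullet> p)
    = - ((functional p \<bullet> r) * (functional r \<bullet> q) * (functional q \<bullet> p))"
    if int: "p \<in> interior_outcomes" "q \<in> interior_outcomes" "r \<in> interior_outcomes"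
      and pq: "(p, q) \<in> P" and qr: "(q, r) \<in> P" and ne: "\<not> indiff P p r" for p q r
  proof -
    have D: "p \<in> outcomes" "q \<in> outcomes" "r \<in> outcomes"
      using int interior_outcomesD by auto
    have s: "functional q \<bullet> p > 0" "functional q \<bullet> r < 0"
      using functional int D pq qr by auto
    define t where "t = functional q \<bullet> p / (functional q \<bullet> p - functional q \<bullet> r)"
    have t: "0 < t" "t < 1"
      using s by (auto simp: t_def field_simps)
    have z: "(1 - t) * (functional q \<bullet> p) = - (t * (functional q \<bullet> r))"
      using s by (simp add: t_def field_simps)
    have xi: "mix p (1 - t) r \<in> interior_outcomes"
      using int D t by (intro interior_mix) auto
    have "functional q \<bullet> mix p (1 - t) r = 0"
      using z by (simp add: inner_mix)
    then have "functional (mix p (1 - t) r) \<bullet> q = 0"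
      using functional_commute(3) xi int by blast
    then have "(1 - t) * (functional p \<bullet> q) * (functional r \<bullet> p) = t * (functional r \<bullet> q) * (functional p \<bullet> r)"
      by (intro functional_segment_zero int D ne t)
    then have "(1 - t) * (functional p \<bullet> q) * (functional r \<bullet> p) * (functional q \<bullet> r)
        = (t * (functional q \<bullet> r)) * ((functional r \<bullet> q) * (functional p \<bullet> r))"
      by simp
    also have "\<dots> = - ((1 - t) * (functional q \<bullet> p)) * ((functional r \<bullet> q) * (functional p \<bullet> r))"
      using z by simp
    finally have "(1 - t) * ((functional p \<bullet> q) * (functional q \<bullet> r) * (functional r \<bullet> p))
        = (1 - t) * - ((functional p \<bullet> r) * (functional r \<bullet> q) * (functional q \<bullet> p))"
      by (simp add: algebra_simps)
    then show ?thesis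
      using t by (simp only: mult_cancel_left) auto
  qed
  have ne': "\<not> indiff P q p" "\<not> indiff P r q" "\<not> indiff P r p"
    using ne indiff_sym by auto
  \<comment> \<open>Three outcomes without indifferences always contain a chain of two strict
    preferences, and the identity is invariant under permuting the outcomes.\<close>
  have "(p, q) \<in> P \<or> (q, p) \<in> P" "(q, r) \<in> P \<or> (r, q) \<in> P" "(p, r) \<in> P \<or> (r, p) \<in> P"
    using ne int interior_outcomesD by (auto simp: indiff_def)
  then consider "(p, q) \<in> P" "(q, r) \<in> P" | "(p, r) \<in> P" "(r, q) \<in> P" | "(q, p) \<in> P" "(p, r) \<in> P"
    | "(q, r) \<in> P" "(r, p) \<in> P" | "(r, p) \<in> P" "(p, q) \<in> P" | "(r, q) \<in> P" "(q, p) \<in> P"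
    by blast
  then show ?thesis
  proof cases
    case 1
    then show ?thesis using main [of p q r] int ne by simp
  next
    case 2
    then show ?thesis using main [of p r q] int ne by (simp add: mult_ac)
  next
    case 3
    then show ?thesis using main [of q p r] int ne by (simp add: mult_ac)
  next
    case 4
    then show ?thesis using main [of q r p] int ne' by (simp add: mult_ac)
  next
    case 5
    then show ?thesis using main [of r p q] int ne' by (simp add: mult_ac)
  next
    case 6
    then show ?thesis using main [of r q p] int ne' by (simp add: mult_ac)
  qed
qed

subsection \<open>Representation by skew-symmetric matrices\<close>

text \<open>A reference outcome \<open>c\<close> fixes the scales: the cycle condition makes the
  rescaled functionals skew on the full-support outcomes not indifferent to \<open>c\<close>. The
  matrix is read off from a small copy of the simplex, and the representation is then extended to
  all outcomes by approximation.\<close>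

theorem SSB_matrix:
  "\<exists>M :: 'a \<Rightarrow> 'a \<Rightarrow> real. (\<forall>a b. M a b = - M b a) \<and> (\<forall>p\<in>outcomes. \<forall>q\<in>outcomes. (p, q) \<in> P \<longleftrightarrow> 0 < bil M p q)"
proof (cases "P = {}")
  case True
  then show ?thesis
    by (intro exI [of _ "\<lambda>_ _. 0"]) (simp add: bil_def)
next
  case False
  then obtain x y where xy: "(x, y) \<in> P"
    by auto
  obtain z :: "real ^ 'a" where z: "z \<in> interior_outcomes"
    using interior_nonempty by blast
  have zD: "z \<in> outcomes"
    using z interior_outcomesD by blast
  have near: "\<forall>\<^sub>F t in at_right (0::real). t \<in> {0<..<1}"
    by (rule eventually_at_right_real) simp
  have inner_near: "mix u (1 - t) v \<in> interior_outcomes"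
    if "t \<in> {0<..<1}" "u \<in> outcomes" "v \<in> interior_outcomes" for t u v
    using interior_mix [of v u t] that by (auto simp: mix_swap [of u])
  note ex_right = eventually_happens' [OF trivial_limit_at_right_real [of "0::real"]]
  \<comment> \<open>First \<open>x\<close>, then \<open>y\<close> is moved to full support without
    losing the strict preference.\<close>
  have "\<exists>t. (mix x (1 - t) z, y) \<in> P \<and> t \<in> {0<..<1}"
    by (intro ex_right eventually_conj near upper_eventually [OF xy tendsto_mix]
        eventually_mix_outcomes zD) (use xy in_outcomes in blast)
  then obtain c where oP: "(c, y) \<in> P" and oI: "c \<in> interior_outcomes"
    using inner_near xy z in_outcomes by blast
  have "\<exists>t. (c, mix y (1 - t) z) \<in> P \<and> t \<in> {0<..<1}"
    by (intro ex_right eventually_conj near lower_eventually [OF oP tendsto_mix]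
        eventually_mix_outcomes zD) (use xy in_outcomes in blast)
  then obtain b where obP: "(c, b) \<in> P" and bI: "b \<in> interior_outcomes"
    using inner_near xy z in_outcomes by blast
  define A where "A = {x \<in> interior_outcomes. functional c \<bullet> x \<noteq> 0}"
  have bA: "b \<in> A"
    using obP bI functional(2) [OF oI interior_outcomesD [OF bI]] by (simp add: A_def)
  have AI: "x \<in> interior_outcomes" and AD: "x \<in> outcomes" and A0: "functional c \<bullet> x \<noteq> 0" if "x \<in> A" for x
    using that interior_outcomesD by (auto simp: A_def)
  \<comment> \<open>With this scale \<open>g x \<bullet> c = - (functional c \<bullet> x)\<close>,
    and the cycle condition for \<open>c\<close>, \<open>x\<close>, \<open>y\<close> reads as skew
    symmetry of \<open>g\<close>.\<close>
  define k where "k = (\<lambda>x. - (functional c \<bullet> x) / (functional x \<bullet> c))"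
  define g where "g = (\<lambda>x. k x *\<^sub>R functional x)"
  have gpos: "k x > 0" if "x \<in> A" for x
    using functional_commute [OF oI AI [OF that]] A0 [OF that] by (auto simp: k_def divide_simps)
  have gsign: "(z, x) \<in> P \<longleftrightarrow> 0 < g x \<bullet> z" "(x, z) \<in> P \<longleftrightarrow> g x \<bullet> z < 0" if "x \<in> A" "z \<in> outcomes" for x z
    using functional [OF AI [OF that(1)] that(2)] gpos [OF that(1)]
    by (auto simp: g_def zero_less_mult_iff mult_less_0_iff)
  have gskew: "g x \<bullet> y = - (g y \<bullet> x)" if x: "x \<in> A" and y: "y \<in> A" for x y
  proof (cases "indiff P x y")
    case True
    then show ?thesis
      using functional_indiff [of x y] functional_indiff [of y x] AI AD x y indiff_sym by (simp add: g_def)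
  next
    case False
    have nz: "functional x \<bullet> c \<noteq> 0" "functional y \<bullet> c \<noteq> 0"
      using functional_commute(3) [OF oI] AI A0 x y by blast+
    have "\<not> indiff P c x" "\<not> indiff P c y"
      using functional_indiff [OF oI] AD A0 x y by blast+
    then have "(functional c \<bullet> x) * (functional x \<bullet> y) * (functional y \<bullet> c)
      = - ((functional c \<bullet> y) * (functional y \<bullet> x) * (functional x \<bullet> c))"
      using False by (intro cycle oI AI x y)
    then show ?thesis
      using nz by (simp add: g_def k_def field_simps)
  qed
  \<comment> \<open>Contracting the vertices far enough towards \<open>b\<close> keeps them off the
    zero set of \<open>functional c\<close>.\<close>
  have "\<forall>\<^sub>F e in at_right 0. e \<in> {0<..<1} \<and> (\<forall>a. functional c \<bullet> mix b (1 - e) (pure a) \<noteq> 0)"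
  proof (intro eventually_conj near eventually_all_finite)
    fix a
    have "((\<lambda>e. functional c \<bullet> mix b (1 - e) (pure a)) \<longlongrightarrow> functional c \<bullet> b) (at_right 0)"
      by (intro tendsto_intros tendsto_mix)
    then show "\<forall>\<^sub>F e in at_right 0. functional c \<bullet> mix b (1 - e) (pure a) \<noteq> 0"
      by (rule tendsto_imp_eventually_ne) (rule A0 [OF bA])
  qed
  then obtain e where e: "e \<in> {0<..<1}" "\<And>a. functional c \<bullet> mix b (1 - e) (pure a) \<noteq> 0"
    using ex_right by blast
  define B where "B = (\<lambda>a. mix b (1 - e) (pure a))"
  have BA: "B a \<in> A" for a
    unfolding A_def B_def using e by (auto intro!: interior_mix bI)
  have Bsum: "(\<Sum>a\<in>UNIV. z $ a *\<^sub>R B a) = mix b (1 - e) z" if "z \<in> outcomes" for z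
  proof -
    have "(\<Sum>a\<in>UNIV. z $ a *\<^sub>R B a) $ i = mix b (1 - e) z $ i" for i
    proof -
      have "(\<Sum>a\<in>UNIV. z $ a *\<^sub>R B a) $ i = (\<Sum>a\<in>UNIV. z $ a * ((1 - e) * b $ i) + e * (z $ a * pure a $ i))"
        by (simp add: B_def algebra_simps)
      also have "\<dots> = (\<Sum>a\<in>UNIV. z $ a) * ((1 - e) * b $ i) + e * (\<Sum>a\<in>UNIV. z $ a * pure a $ i)"
        by (simp add: sum.distrib sum_distrib_left sum_distrib_right)
      also have "(\<Sum>a\<in>UNIV. z $ a * pure a $ i) = z $ i"
        by (simp add: pure_def axis_def if_distrib cong: if_cong)
      also have "(\<Sum>a\<in>UNIV. z $ a) = 1"
        using that by (simp add: outcomes_def)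
      finally show ?thesis
        by simp
    qed
    then show ?thesis
      by (simp add: vec_eq_iff)
  qed
  \<comment> \<open>The vertices are recovered from \<open>pure a = (B a - (1 - e) b) / e\<close>.\<close>
  define H where "H = (\<Sum>a\<in>UNIV. b $ a *\<^sub>R g (B a))"
  define V where "V = (\<lambda>a. (g (B a) - (1 - e) *\<^sub>R H) /\<^sub>R e)"
  define M where "M = (\<lambda>a k. V k $ a)"
  have bilM: "bil M x y = (\<Sum>k\<in>UNIV. y $ k * (V k \<bullet> x))" for x y
    unfolding bil_def M_def inner_vec_def
    by (subst sum.swap) (simp add: sum_distrib_left mult_ac)
  have Msum: "(\<Sum>k\<in>UNIV. y $ k * (g (B k) \<bullet> x)) = - (g x \<bullet> mix b (1 - e) y)"
    if "x \<in> A" "y \<in> outcomes" for x y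
  proof -
    have "(\<Sum>k\<in>UNIV. y $ k * (g (B k) \<bullet> x)) = - (\<Sum>k\<in>UNIV. y $ k * (g x \<bullet> B k))"
      using gskew [OF BA that(1)] by (simp add: sum_negf)
    also have "(\<Sum>k\<in>UNIV. y $ k * (g x \<bullet> B k)) = g x \<bullet> (\<Sum>k\<in>UNIV. y $ k *\<^sub>R B k)"
      by (simp add: inner_sum_right)
    finally show ?thesis
      using Bsum that by simp
  qed
  \<comment> \<open>The sign changes because \<open>g x\<close> is positive at outcomes better than
    \<open>x\<close>, whereas the form is to be positive if the first argument is better.\<close>
  have M: "bil M x y = - (g x \<bullet> y)" if x: "x \<in> A" and y: "y \<in> outcomes" for x y
  proof -
    have "H \<bullet> x = - (g x \<bullet> b)"
      using Msum [OF x AD [OF bA]] by (simp add: H_def inner_sum_left)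
    then have "e * (V k \<bullet> x) = g (B k) \<bullet> x + (1 - e) * (g x \<bullet> b)" for k
      using e by (simp add: V_def inner_diff_left)
    then have "e * bil M x y = (\<Sum>k\<in>UNIV. y $ k * (g (B k) \<bullet> x + (1 - e) * (g x \<bullet> b)))"
      by (simp only: bilM sum_distrib_left mult.left_commute [of e])
    also have "\<dots> = - (g x \<bullet> mix b (1 - e) y) + (\<Sum>k\<in>UNIV. y $ k) * ((1 - e) * (g x \<bullet> b))"
      using Msum [OF x y] by (simp add: distrib_left sum.distrib sum_distrib_right)
    also have "(\<Sum>k\<in>UNIV. y $ k) = 1"
      using y by (simp add: outcomes_def)
    finally have "e * bil M x y = e * - (g x \<bullet> y)"
      by (simp add: inner_mix)
    then show ?thesis
      using e by (simp only: mult_cancel_left) auto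
  qed
  have MA: "bil M x y = - bil M y x" if "x \<in> A" "y \<in> A" for x y
    using M [OF that(1) AD [OF that(2)]] M [OF that(2) AD [OF that(1)]] gskew [OF that] by simp
  have skew: "M a k = - M k a" for a k
  proof -
    have "bil M (B a) (B k) = - bil M (B k) (B a)" "bil M (B a) b = - bil M b (B a)"
      "bil M b (B k) = - bil M (B k) b" "bil M b b = 0"
      using MA [OF BA BA, of a k] MA [OF BA bA, of a] MA [OF bA BA, of k] MA [OF bA bA] by simp_all
    then have "e * (e * M a k) = e * (e * - M k a)"
      by (simp add: B_def bil_mix_left bil_mix_right algebra_simps)
    then show ?thesis
      using e by (simp only: mult_cancel_left) auto
  qed
  have sk: "bil M x y = - bil M y x" for x y
    by (rule bil_skew [OF skew])
  have sgn1: "(x, y) \<in> P \<longleftrightarrow> 0 < bil M x y" "(y, x) \<in> P \<longleftrightarrow> bil M x y < 0" if "x \<in> A" "y \<in> outcomes" for x y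
    using M gsign that by auto
  \<comment> \<open>Along the segment, \<open>functional c\<close> is affine and nonzero at
    \<open>w\<close>, so close to \<open>x\<close> it has no zero except possibly \<open>x\<close>
    itself.\<close>
  have nearA: "\<forall>\<^sub>F t in at_right 0. mix x (1 - t) w \<in> A" if x: "x \<in> outcomes" and w: "w \<in> A" for x w
  proof -
    have "\<forall>\<^sub>F t in at_right 0. functional c \<bullet> mix x (1 - t) w \<noteq> 0"
    proof (cases "functional c \<bullet> x = 0")
      case True
      have "\<forall>\<^sub>F t in at_right (0::real). 0 < t"
        by (rule eventually_at_right_less)
      then show ?thesis
        by eventually_elim (use True A0 [OF w] in \<open>simp add: inner_mix\<close>)
    next
      case False
      have "((\<lambda>t. functional c \<bullet> mix x (1 - t) w) \<longlongrightarrow> functional c \<bullet> x) (at_right 0)"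
        by (intro tendsto_intros tendsto_mix)
      then show ?thesis
        by (rule tendsto_imp_eventually_ne) (rule False)
    qed
    then show ?thesis
      using near
    proof eventually_elim
      case (elim t)
      then show ?case
        using inner_near [OF _ x AI [OF w]] by (simp add: A_def)
    qed
  qed
  have limM: "((\<lambda>t. bil M (mix x (1 - t) w) y) \<longlongrightarrow> bil M x y) (at_right 0)" for x w y
    unfolding bil_mix_left by (auto intro!: tendsto_eq_intros)
  have "(x, y) \<in> P \<longleftrightarrow> 0 < bil M x y" if xy: "x \<in> outcomes" "y \<in> outcomes" for x y
  proof -
    \<comment> \<open>If \<open>x\<close> and \<open>y\<close> are strictly compared, by the
      relation or by the form, then so is each of them with \<open>m\<close>, on opposite sides.
      This strictness allows replacing first \<open>y\<close> by some \<open>w\<close> in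
      \<open>A\<close> and then \<open>x\<close> by a mixture with \<open>w\<close>, where the
      representation is known.\<close>
    define m where "m = mix x (1/2) y"
    have mD: "m \<in> outcomes"
      unfolding m_def by (intro outcomes_mix xy) auto
    have Mm: "bil M x m = bil M x y / 2" "bil M y m = - bil M x y / 2"
      using sk [of x x] sk [of y y] sk [of y x] by (simp_all add: m_def bil_mix_right)
    show ?thesis
    proof
      assume P: "(x, y) \<in> P"
      then have xm: "(x, m) \<in> P" and my: "(m, y) \<in> P"
        unfolding m_def using above_mix [of x y "1/2"] mix_above [of x y "1/2"] by auto
      have "\<exists>t. mix y (1 - t) b \<in> A \<and> (m, mix y (1 - t) b) \<in> P"
        by (intro ex_right eventually_conj nearA bA lower_eventually [OF my tendsto_mix]
            eventually_mix_outcomes AD xy)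
      then obtain w where w: "w \<in> A" "(m, w) \<in> P"
        by blast
      then have wm: "bil M w m < 0"
        using sgn1 mD by blast
      show "0 < bil M x y"
      proof (rule ccontr)
        assume "\<not> 0 < bil M x y"
        have "\<exists>t. t \<in> {0<..<1} \<and> mix x (1 - t) w \<in> A \<and> (mix x (1 - t) w, m) \<in> P"
          by (intro ex_right eventually_conj near nearA w upper_eventually [OF xm tendsto_mix]
              eventually_mix_outcomes AD xy)
        then obtain t where t: "t \<in> {0<..<1}" "mix x (1 - t) w \<in> A" "(mix x (1 - t) w, m) \<in> P"
          by blast
        then have "0 < (1 - t) * bil M x m + t * bil M w m"
          using sgn1 [OF t(2) mD] by (simp add: bil_mix_left)
        moreover have "(1 - t) * bil M x m \<le> 0" "t * bil M w m \<le> 0"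
          using t wm \<open>\<not> 0 < bil M x y\<close> Mm by (auto simp: mult_nonneg_nonpos)
        ultimately show False
          by linarith
      qed
    next
      assume pos: "0 < bil M x y"
      show "(x, y) \<in> P"
      proof (rule ccontr)
        assume nP: "(x, y) \<notin> P"
        have xm: "(x, m) \<notin> P"
          unfolding m_def by (intro not_below_mix nP xy) auto
        have "((\<lambda>t. bil M (mix y (1 - t) b) m) \<longlongrightarrow> bil M y m) (at_right 0)"
          by (rule limM)
        then have "\<exists>t. mix y (1 - t) b \<in> A \<and> bil M (mix y (1 - t) b) m < 0"
          using Mm pos by (intro ex_right eventually_conj nearA bA xy order_tendstoD(2)) auto
        then obtain w where w: "w \<in> A" "bil M w m < 0"
          by blast
        then have "(w, m) \<notin> P"
          using sgn1 mD asym by blast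
        have "\<exists>t. t \<in> {0<..<1} \<and> mix x (1 - t) w \<in> A \<and> 0 < bil M (mix x (1 - t) w) m"
          using Mm pos by (intro ex_right eventually_conj near nearA w xy order_tendstoD(1) [OF limM]) auto
        then obtain t where t: "t \<in> {0<..<1}" "mix x (1 - t) w \<in> A" "0 < bil M (mix x (1 - t) w) m"
          by blast
        then have "(mix x (1 - t) w, m) \<in> P"
          using sgn1 mD by blast
        moreover have "(mix x (1 - t) w, m) \<notin> P"
          by (intro not_above_mix xm \<open>(w, m) \<notin> P\<close> xy AD w) (use t in auto)
        ultimately show False
          by blast
      qed
    qed
  qed
  with skew show ?thesis
    by blast
qed

end

section \<open>Uniqueness of the representation\<close>

text \<open>Preserving two-point mixtures makes both \<open>F\<close> and \<open>- F\<close> convex,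
  so Jensen's inequality for finite sums holds in both directions.\<close>

lemma affine_outcomes:
  assumes F: "\<And>p q l. p \<in> outcomes \<Longrightarrow> q \<in> outcomes \<Longrightarrow> 0 \<le> l \<Longrightarrow> l \<le> 1 \<Longrightarrow>
      F (mix p l q) = l * F p + (1 - l) * F q"
    and p: "p \<in> outcomes"
  shows "F p = (\<Sum>a\<in>UNIV. p $ a * F (pure a))"
proof -
  have conv: "convex (outcomes :: (real ^ 'a) set)"
    unfolding convex_alt using outcomes_mix by (auto simp: mix_def add.commute)
  have le: "G p \<le> (\<Sum>a\<in>UNIV. p $ a * G (pure a))"
    if G: "\<And>p q l. p \<in> outcomes \<Longrightarrow> q \<in> outcomes \<Longrightarrow> 0 \<le> l \<Longrightarrow> l \<le> 1 \<Longrightarrow>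
      G (mix p l q) = l * G p + (1 - l) * G q" for G :: "real ^ 'a \<Rightarrow> real"
  proof -
    have "convex_on outcomes G"
    proof (rule convex_onI [OF _ conv])
      fix t :: real and x y :: "real ^ 'a"
      assume "0 < t" "t < 1" "x \<in> outcomes" "y \<in> outcomes"
      then show "G ((1 - t) *\<^sub>R x + t *\<^sub>R y) \<le> (1 - t) * G x + t * G y"
        using G [of x y "1 - t"] by (simp add: mix_def)
    qed
    then have "G (\<Sum>a\<in>UNIV. p $ a *\<^sub>R pure a) \<le> (\<Sum>a\<in>UNIV. p $ a * G (pure a))"
    proof (intro convex_on_sum)
      show "sum (($) p) UNIV = 1" "0 \<le> p $ a" for a
        using p by (simp_all add: outcomes_def)
    qed auto
    moreover have "(\<Sum>a\<in>UNIV. p $ a *\<^sub>R pure a) = p"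
      by (simp add: vec_eq_iff pure_def axis_def if_distrib cong: if_cong)
    ultimately show ?thesis
      by simp
  qed
  have "- F p \<le> (\<Sum>a\<in>UNIV. p $ a * - F (pure a))"
    by (rule le) (simp add: F algebra_simps)
  then show ?thesis
    using le [of F, OF F] by (simp add: sum_negf)
qed

lemma SSB_mix:
  assumes "SSB \<phi>" "p \<in> outcomes" "q \<in> outcomes" "r \<in> outcomes" "0 \<le> l" "l \<le> 1"
  shows "\<phi> (mix p l q) r = l * \<phi> p r + (1 - l) * \<phi> q r"
    "\<phi> r (mix p l q) = l * \<phi> r p + (1 - l) * \<phi> r q"
proof -
  have "\<forall>p\<in>outcomes. \<forall>q\<in>outcomes. \<forall>r\<in>outcomes. \<forall>l\<in>{0..1}.
      \<phi> (mix p l q) r = l * \<phi> p r + (1 - l) * \<phi> q r \<and>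
      \<phi> r (mix p l q) = l * \<phi> r p + (1 - l) * \<phi> r q"
    using assms(1) unfolding SSB_def by blast
  moreover have "l \<in> {0..1}"
    using assms by simp
  ultimately show "\<phi> (mix p l q) r = l * \<phi> p r + (1 - l) * \<phi> q r"
    "\<phi> r (mix p l q) = l * \<phi> r p + (1 - l) * \<phi> r q"
    using assms(2-4) by blast+
qed

lemma SSB_skew: "SSB \<phi> \<Longrightarrow> p \<in> outcomes \<Longrightarrow> q \<in> outcomes \<Longrightarrow> \<phi> p q = - \<phi> q p"
  unfolding SSB_def by blast

lemma SSB_bil:
  assumes "SSB \<phi>" "p \<in> outcomes" "q \<in> outcomes"
  shows "\<phi> p q = bil (\<lambda>a b. \<phi> (pure a) (pure b)) p q"
proof -
  have "\<phi> p q = (\<Sum>a\<in>UNIV. p $ a * \<phi> (pure a) q)"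
    by (intro affine_outcomes [of "\<lambda>p. \<phi> p q"] SSB_mix assms)
  also have "\<dots> = (\<Sum>a\<in>UNIV. p $ a * (\<Sum>b\<in>UNIV. q $ b * \<phi> (pure a) (pure b)))"
    by (intro sum.cong refl arg_cong2 [of _ _ _ _ "(*)"] affine_outcomes SSB_mix assms pure_outcomes)
  also have "\<dots> = bil (\<lambda>a b. \<phi> (pure a) (pure b)) p q"
    by (simp add: bil_def sum_distrib_left mult.assoc)
  finally show ?thesis .
qed

text \<open>Rows with equal signs have the same zeros. If the row of \<open>M\<close> has opposite
  signs at \<open>y\<close> and \<open>z\<close>, a zero between them fixes the proportion. If the
  signs are equal, \<open>y\<close> is first reflected through \<open>p\<close>, where the row
  vanishes.\<close>

lemma bil_row_proportional:
  assumes p: "p \<in> interior_outcomes" and skew: "bil M p p = 0"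
    and sgn: "\<And>q. q \<in> outcomes \<Longrightarrow> sgn (bil M p q) = sgn (bil N p q)"
    and y: "y \<in> outcomes" "bil M p y \<noteq> 0" and z: "z \<in> outcomes"
  shows "bil N p z * bil M p y = bil M p z * bil N p y"
proof -
  have opp: "bil N p z * bil M p y = bil M p z * bil N p y"
    if "y \<in> outcomes" "z \<in> outcomes" "bil M p y * bil M p z < 0" for y z
  proof -
    let ?u = "bil M p y" and ?v = "bil M p z"
    define t where "t = - ?v / (?u - ?v)"
    have uv: "?u - ?v \<noteq> 0" "0 \<le> t" "t \<le> 1"
      using that(3) unfolding t_def by (auto simp: mult_less_0_iff divide_simps)
    have t: "t * (?u - ?v) = - ?v"
      using uv(1) by (simp add: t_def)
    have "bil M p (mix y t z) = 0"
      using t by (simp add: bil_mix_right algebra_simps)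
    then have "bil N p (mix y t z) = 0"
      using sgn [of "mix y t z"] that uv by (simp add: outcomes_mix sgn_0_0)
    then have "t * bil N p y + (1 - t) * bil N p z = 0"
      by (simp add: bil_mix_right)
    moreover have "(t * (?u - ?v)) * bil N p y + ((?u - ?v) - t * (?u - ?v)) * bil N p z
        = (?u - ?v) * (t * bil N p y + (1 - t) * bil N p z)"
      by (simp add: algebra_simps)
    ultimately have "(t * (?u - ?v)) * bil N p y + ((?u - ?v) - t * (?u - ?v)) * bil N p z = 0"
      by simp
    then show ?thesis
      unfolding t by (simp add: algebra_simps)
  qed
  consider "bil M p z = 0" | "bil M p y * bil M p z < 0" | "bil M p y * bil M p z > 0"
    using y(2) by (meson linorder_neqE_linordered_idom mult_eq_0_iff)
  then show ?thesis
  proof cases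
    case 1
    then show ?thesis
      using sgn [OF z] by (simp add: sgn_0_0)
  next
    case 2
    then show ?thesis
      by (intro opp y z)
  next
    case 3
    obtain y' l where y': "y' \<in> interior_outcomes" "0 < l" "l < 1" "p = mix y l y'"
      using interior_reflect [OF p y(1)] by blast
    have y'D: "y' \<in> outcomes"
      using y' interior_outcomesD by blast
    have "l * bil M p y + (1 - l) * bil M p y' = 0"
      using skew y'(4) bil_mix_right [of M p y l y'] by simp
    then have "bil M p y * (l * bil M p y + (1 - l) * bil M p y') = 0"
      by simp
    then have "(1 - l) * (bil M p y * bil M p y') = - l * (bil M p y)\<^sup>2"
      by (simp add: algebra_simps power2_eq_square)
    then have "(1 - l) * (bil M p y * bil M p y') < 0"
      using y'(2) y(2) by (simp add: mult_less_0_iff)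
    then have neg: "bil M p y * bil M p y' < 0"
      using y' by (simp add: mult_less_0_iff)
    then have neg': "bil M p y' * bil M p z < 0"
      using 3 by (auto simp: mult_less_0_iff zero_less_mult_iff)
    have "bil M p y' * (bil N p z * bil M p y) = (bil N p z * bil M p y') * bil M p y"
      by simp
    also have "\<dots> = bil M p z * (bil N p y' * bil M p y)"
      using opp [OF y'D z neg'] by simp
    also have "\<dots> = bil M p y' * (bil M p z * bil N p y)"
      using opp [OF y(1) y'D neg] by simp
    finally show ?thesis
      using neg by (auto simp: mult_less_0_iff)
  qed
qed

text \<open>Rows at full-support outcomes are proportional, and it remains to match the factors. The
  entry at \<open>p0\<close>, \<open>q0\<close> fixes \<open>c\<close>; skew symmetry carries it
  from row \<open>p0\<close> to row \<open>q0\<close> and, through entries at \<open>p0\<close>, to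
  rows of suitable mixtures of \<open>x\<close> with \<open>q0\<close>. Subtracting row
  \<open>q0\<close> leaves row \<open>x\<close>.\<close>

theorem SSB_matrix_unique:
  fixes M N :: "'a::finite \<Rightarrow> 'a \<Rightarrow> real"
  assumes skew: "\<And>a b. M a b = - M b a" "\<And>a b. N a b = - N b a"
    and sgn: "\<And>p q. p \<in> outcomes \<Longrightarrow> q \<in> outcomes \<Longrightarrow> sgn (bil M p q) = sgn (bil N p q)"
  shows "\<exists>c>0. \<forall>p\<in>outcomes. \<forall>q\<in>outcomes. bil N p q = c * bil M p q"
proof (cases "\<exists>p\<in>outcomes. \<exists>q\<in>outcomes. bil M p q > 0")
  case False
  have "bil M p q = 0" if "p \<in> outcomes" "q \<in> outcomes" for p q
    using False that bil_skew [of M p q, OF skew(1)] by (smt (verit))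
  then show ?thesis
    using sgn by (intro exI [of _ 1]) (auto simp: sgn_0_0)
next
  case True
  then obtain p q where pq: "p \<in> outcomes" "q \<in> outcomes" "bil M p q > 0"
    by blast
  obtain z :: "real ^ 'a" where z: "z \<in> interior_outcomes"
    using interior_nonempty by blast
  have zD: "z \<in> outcomes"
    using z interior_outcomesD by blast
  have near: "\<forall>\<^sub>F t in at_right (0::real). t \<in> {0<..<1}"
    by (rule eventually_at_right_real) simp
  have inner_near: "mix u (1 - t) z \<in> interior_outcomes" if "t \<in> {0<..<1}" "u \<in> outcomes" for t u
    using interior_mix [OF z that(2), of t] that by (auto simp: mix_swap [of u])
  have limM: "((\<lambda>t. bil M (mix x (1 - t) w) y) \<longlongrightarrow> bil M x y) (at_right 0)"
    "((\<lambda>t. bil M y (mix x (1 - t) w)) \<longlongrightarrow> bil M y x) (at_right 0)" for x w y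
    unfolding bil_mix_left bil_mix_right by (auto intro!: tendsto_eq_intros)
  note ex_right = eventually_happens' [OF trivial_limit_at_right_real [of "0::real"]]
  have "\<exists>t. t \<in> {0<..<1} \<and> 0 < bil M (mix p (1 - t) z) q"
    using pq by (intro ex_right eventually_conj near order_tendstoD(1) [OF limM(1)])
  then obtain p0 where p0: "p0 \<in> interior_outcomes" "0 < bil M p0 q"
    using inner_near pq by blast
  have "\<exists>t. t \<in> {0<..<1} \<and> 0 < bil M p0 (mix q (1 - t) z)"
    using p0 by (intro ex_right eventually_conj near order_tendstoD(1) [OF limM(2)])
  then obtain q0 where q0: "q0 \<in> interior_outcomes" "0 < bil M p0 q0"
    using inner_near pq by blast
  have D: "p0 \<in> outcomes" "q0 \<in> outcomes"
    using p0 q0 interior_outcomesD by auto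
  have self: "bil M x x = 0" for x
    using bil_skew [of M x x, OF skew(1)] by simp
  define c where "c = bil N p0 q0 / bil M p0 q0"
  have "0 < bil N p0 q0"
    using sgn [OF D] q0(2) by (simp add: sgn_1_pos)
  then have c: "0 < c"
    using q0(2) by (simp add: c_def)
  have propor: "bil N x w = c * bil M x w"
    if x: "x \<in> interior_outcomes" "y \<in> outcomes" "bil M x y \<noteq> 0" "bil N x y = c * bil M x y" "w \<in> outcomes"
    for x y w
  proof -
    have "bil N x w * bil M x y = bil M x w * bil N x y"
      using x interior_outcomesD sgn self by (intro bil_row_proportional) auto
    then show ?thesis
      using x by (simp add: mult_ac)
  qed
  have N0: "bil N p0 q0 = c * bil M p0 q0"
    using q0 by (simp add: c_def)
  have rowp: "bil N p0 w = c * bil M p0 w" if "w \<in> outcomes" for w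
    using propor [OF p0(1) D(2) _ N0 that] q0(2) by simp
  have N1: "bil N q0 p0 = c * bil M q0 p0"
    using N0 bil_skew [of M q0 p0, OF skew(1)] bil_skew [of N q0 p0, OF skew(2)] by simp
  have rowq: "bil N q0 w = c * bil M q0 w" if "w \<in> outcomes" for w
    using propor [OF q0(1) D(1) _ N1 that] q0(2) bil_skew [of M q0 p0, OF skew(1)] by simp
  have "bil N x w = c * bil M x w" if x: "x \<in> outcomes" and w: "w \<in> outcomes" for x w
  proof -
    have "\<forall>\<^sub>F t in at_right 0. bil M (mix x (1 - t) q0) p0 \<noteq> 0"
    proof (cases "bil M x p0 = 0")
      case True
      have "\<forall>\<^sub>F t in at_right (0::real). 0 < t"
        by (rule eventually_at_right_less)
      then show ?thesis
        by eventually_elim (use True q0 bil_skew [of M q0 p0, OF skew(1)] in \<open>simp add: bil_mix_left\<close>)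
    next
      case False
      show ?thesis
        by (rule tendsto_imp_eventually_ne [OF limM(1) False])
    qed
    then have "\<exists>t. t \<in> {0<..<1} \<and> bil M (mix x (1 - t) q0) p0 \<noteq> 0"
      by (intro ex_right eventually_conj near)
    then obtain t where t: "0 < t" "t < 1" and ne: "bil M (mix x (1 - t) q0) p0 \<noteq> 0"
      by auto
    have xI: "mix x (1 - t) q0 \<in> interior_outcomes"
      using interior_mix [OF q0(1) x, of t] t by (simp add: mix_swap [of x])
    have xD: "mix x (1 - t) q0 \<in> outcomes"
      using xI interior_outcomesD by blast
    have "bil N (mix x (1 - t) q0) p0 = c * bil M (mix x (1 - t) q0) p0"
      using rowp [OF xD] bil_skew [of M _ p0, OF skew(1)] bil_skew [of N _ p0, OF skew(2)] by simp
    then have "bil N (mix x (1 - t) q0) w = c * bil M (mix x (1 - t) q0) w"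
      by (rule propor [OF xI D(1) ne _ w])
    then have "(1 - t) * bil N x w = (1 - t) * (c * bil M x w)"
      using rowq [OF w] by (simp add: bil_mix_left algebra_simps)
    then show ?thesis
      using t by (simp only: mult_cancel_left) auto
  qed
  with c show ?thesis
    by blast
qed

section \<open>Signs determined by the edges of the simplex\<close>

text \<open>If \<open>u\<close> takes both signs, zeros on edges between vertices of opposite sign
  force \<open>v\<close> to be a positive multiple of \<open>u\<close>. Otherwise both sums have the
  same weak sign and vanish exactly if \<open>z\<close> is supported on the common zeros of
  \<open>u\<close> and \<open>v\<close>.\<close>

lemma sgn_edges:
  fixes u v :: "'a::finite \<Rightarrow> real"
  assumes edge: "\<And>a b l. 0 \<le> l \<Longrightarrow> l \<le> 1 \<Longrightarrow> sgn (l * u a + (1 - l) * u b) = sgn (l * v a + (1 - l) * v b)"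
    and z: "z \<in> outcomes"
  shows "sgn (\<Sum>a\<in>UNIV. z $ a * u a) = sgn (\<Sum>a\<in>UNIV. z $ a * v a)"
proof -
  have vert: "sgn (u a) = sgn (v a)" for a
    using edge [of 1 a a] by simp
  have pos: "0 < u a \<longleftrightarrow> 0 < v a" and neg: "u a < 0 \<longleftrightarrow> v a < 0" and zero: "u a = 0 \<longleftrightarrow> v a = 0" for a
    using vert [of a] by (metis sgn_1_pos, metis sgn_1_neg, metis sgn_0_0)
  have opp: "u x * v a = v x * u a" if "u a > 0" "u x < 0" for a x
  proof -
    define l where "l = - u x / (u a - u x)"
    have l: "0 \<le> l" "l \<le> 1" "l * (u a - u x) = - u x"
      using that by (auto simp: l_def divide_simps)
    then have "l * u a + (1 - l) * u x = 0"
      by (simp add: algebra_simps)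
    then have "l * v a + (1 - l) * v x = 0"
      using edge [OF l(1,2), of a x] by (simp add: sgn_0_0)
    then have "(u a - u x) * (l * v a + (1 - l) * v x) = 0"
      by simp
    then have "(l * (u a - u x)) * v a + ((u a - u x) - l * (u a - u x)) * v x = 0"
      by (simp add: algebra_simps)
    then show ?thesis
      unfolding l(3) by (simp add: algebra_simps)
  qed
  have nonneg: "0 \<le> z $ a" for a
    using z by (simp add: outcomes_def)
  consider a b where "u a > 0" "u b < 0" | "\<And>a. u a \<ge> 0" | "\<And>a. u a \<le> 0"
    by (meson linorder_not_le)
  then show ?thesis
  proof cases
    case 1
    define c where "c = v a / u a"
    have "c > 0"
      using 1 pos by (simp add: c_def)
    have b: "v b = c * u b"
      using opp [OF 1] 1 by (simp add: c_def field_simps)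
    have "v x = c * u x" for x
    proof -
      consider "u x < 0" | "u x = 0" | "u x > 0"
        by linarith
      then show ?thesis
      proof cases
        assume "u x < 0"
        then show ?thesis
          using opp [OF 1(1), of x] 1 by (simp add: c_def field_simps)
      next
        assume "u x = 0"
        then show ?thesis
          using zero by simp
      next
        assume "u x > 0"
        then show ?thesis
          using opp [OF _ 1(2), of x] b 1 by simp
      qed
    qed
    then have "(\<Sum>a\<in>UNIV. z $ a * v a) = c * (\<Sum>a\<in>UNIV. z $ a * u a)"
      by (simp add: sum_distrib_left mult.left_commute)
    then show ?thesis
      using \<open>c > 0\<close> by (simp add: sgn_mult)
  next
    case 2
    have v: "v a \<ge> 0" for a
      using 2 [of a] neg [of a] by linarith
    have "(\<Sum>a\<in>UNIV. z $ a * u a) = 0 \<longleftrightarrow> (\<Sum>a\<in>UNIV. z $ a * v a) = 0"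
      using 2 v nonneg zero by (simp add: sum_nonneg_eq_0_iff)
    moreover have "(\<Sum>a\<in>UNIV. z $ a * u a) \<ge> 0" "(\<Sum>a\<in>UNIV. z $ a * v a) \<ge> 0"
      using 2 v nonneg by (simp_all add: sum_nonneg)
    ultimately show ?thesis
      by (auto simp: sgn_if)
  next
    case 3
    have v: "v a \<le> 0" for a
      using 3 [of a] pos [of a] by linarith
    have "(\<Sum>a\<in>UNIV. z $ a * - u a) = 0 \<longleftrightarrow> (\<Sum>a\<in>UNIV. z $ a * - v a) = 0"
      using 3 v nonneg zero by (subst (1 2) sum_nonneg_eq_0_iff) (auto simp: mult_nonneg_nonpos)
    moreover have "(\<Sum>a\<in>UNIV. z $ a * u a) \<le> 0" "(\<Sum>a\<in>UNIV. z $ a * v a) \<le> 0"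
      using 3 v nonneg by (simp_all add: sum_nonpos mult_nonneg_nonpos)
    ultimately show ?thesis
      by (auto simp: sgn_if sum_negf)
  qed
qed

text \<open>\<open>sgn_edges\<close> frees one argument at a time: the first while the second is
  still on an edge, then the second.\<close>

lemma sgn_bil_edges:
  fixes M N :: "'a::finite \<Rightarrow> 'a \<Rightarrow> real"
  assumes edge: "\<And>a b c d l m. 0 \<le> l \<Longrightarrow> l \<le> 1 \<Longrightarrow> 0 \<le> m \<Longrightarrow> m \<le> 1 \<Longrightarrow>
      sgn (bil M (mix (pure a) l (pure b)) (mix (pure c) m (pure d)))
      = sgn (bil N (mix (pure a) l (pure b)) (mix (pure c) m (pure d)))"
    and pq: "p \<in> outcomes" "q \<in> outcomes"
  shows "sgn (bil M p q) = sgn (bil N p q)"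
proof -
  have 1: "sgn (bil M p (mix (pure c) m (pure d))) = sgn (bil N p (mix (pure c) m (pure d)))"
    if "0 \<le> m" "m \<le> 1" for c d m
    unfolding bil_sum_left [of _ p]
    by (rule sgn_edges [OF _ pq(1)]) (use edge that in \<open>simp add: bil_mix_left [symmetric]\<close>)
  show ?thesis
    unfolding bil_sum_right [of _ p q]
    by (rule sgn_edges [OF _ pq(2)]) (use 1 in \<open>simp add: bil_mix_right [symmetric]\<close>)
qed

section \<open>Forms on faces of the simplex\<close>

lemma outcomes_on_zero:
  assumes "p \<in> outcomes_on X" "a \<notin> X"
  shows "p $ a = 0"
proof -
  have "(\<Sum>a\<in>UNIV. p $ a) = (\<Sum>a\<in>X. p $ a) + (\<Sum>a\<in>UNIV - X. p $ a)"
    using sum.subset_diff [of X UNIV "($) p"] by simp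
  then have "(\<Sum>a\<in>UNIV - X. p $ a) = 0"
    using assms by (simp add: outcomes_on_def outcomes_def)
  then show ?thesis
    using assms by (simp add: sum_nonneg_eq_0_iff outcomes_on_def outcomes_def)
qed

lemma outcomes_onD: "p \<in> outcomes_on X \<Longrightarrow> p \<in> outcomes"
  by (simp add: outcomes_on_def)

lemma pure_outcomes_on [simp]: "a \<in> X \<Longrightarrow> pure a \<in> outcomes_on X"
  by (simp add: outcomes_on_def) (simp add: pure_def axis_def)

lemma outcomes_on_mix:
  assumes "p \<in> outcomes_on X" "q \<in> outcomes_on X" "0 \<le> l" "l \<le> 1"
  shows "mix p l q \<in> outcomes_on X"
  using assms
  by (simp add: outcomes_on_def outcomes_mix sum.distrib sum_distrib_left [symmetric])

lemma bil_cong_on: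
  assumes "p \<in> outcomes_on X" "q \<in> outcomes_on X" "\<And>x y. x \<in> X \<Longrightarrow> y \<in> X \<Longrightarrow> M x y = c * N x y"
  shows "bil M p q = c * bil N p q"
proof -
  have "p $ a * q $ b * M a b = c * (p $ a * q $ b * N a b)" for a b
    using assms outcomes_on_zero by (cases "a \<in> X"; cases "b \<in> X") auto
  then show ?thesis
    unfolding bil_def sum_distrib_left by (intro sum.cong refl)
qed

text \<open>Equal signs transfer zeros from \<open>M\<close> to \<open>N\<close>, and two
  well-chosen zeros of \<open>M\<close> give two linear equations for the entries of
  \<open>N\<close>. In this way IIA, which transmits only signs, transmits a ratio of
  margins.\<close>

lemma triple_ratio:
  fixes M N :: "'a::finite \<Rightarrow> 'a \<Rightarrow> real"
  assumes skew: "\<And>a b. M a b = - M b a" "\<And>a b. N a b = - N b a"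
    and sgn: "\<And>p q. p \<in> outcomes_on {x, y, e} \<Longrightarrow> q \<in> outcomes_on {x, y, e} \<Longrightarrow> sgn (bil M p q) = sgn (bil N p q)"
    and k: "M x e = k" "M y e = k" "0 < k"
  shows "N x e = N y e" "k * N x y = M x y * N x e"
proof -
  \<comment> \<open>Assuming \<open>M x y \<ge> 0\<close> keeps the weights chosen below in the unit
    interval; the other case exchanges \<open>x\<close> and \<open>y\<close>.\<close>
  have main: "N x e = N y e \<and> k * N x y = M x y * N x e"
    if sgn: "\<And>p q. p \<in> outcomes_on {x, y, e} \<Longrightarrow> q \<in> outcomes_on {x, y, e} \<Longrightarrow> sgn (bil M p q) = sgn (bil N p q)"
      and k: "M x e = k" "M y e = k" and xy: "M x y \<ge> 0" for x y
  proof -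
    define W where "W = M x y / k"
    have W: "0 \<le> W" "M x y = W * k"
      using xy \<open>0 < k\<close> by (auto simp: W_def)
    have M0: "M e e = 0" "N e e = 0" "M e y = - k" "N e y = - N y e"
      using skew(1) [of e e] skew(2) [of e e] skew(1) [of e y] skew(2) [of e y] k by auto
    have z: "bil N p q = 0" if "bil M p q = 0" "p \<in> outcomes_on {x, y, e}" "q \<in> outcomes_on {x, y, e}" for p q
      using sgn [OF that(2,3)] that(1) by (simp add: sgn_0_0)
    \<comment> \<open>With weights in proportion 1 to \<open>W\<close>, the margin
      \<open>W * k\<close> of \<open>x\<close> over \<open>y\<close> balances the margin
      \<open>- k\<close> of \<open>e\<close> over \<open>y\<close>.\<close>
    have "bil N (mix (pure x) (1 / (1 + W)) (pure e)) (pure y) = 0"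
    proof (rule z)
      show "bil M (mix (pure x) (1 / (1 + W)) (pure e)) (pure y) = 0"
        using W by (simp add: bil_mix_left M0 field_simps)
    qed (use W in \<open>auto intro!: outcomes_on_mix\<close>)
    moreover have "1 - 1 / (1 + W) = W * (1 / (1 + W))"
      using W by (simp add: field_simps)
    ultimately have "1 / (1 + W) * (N x y - W * N y e) = 0"
      by (simp add: bil_mix_left M0 algebra_simps)
    then have 1: "N x y = W * N y e"
      using W by simp
    \<comment> \<open>Giving \<open>e\<close> half of the second outcome moves the zero to the
      weight \<open>1 / (2 + W)\<close>; the resulting equation brings in
      \<open>N x e\<close>.\<close>
    define d where "d = 1 / (2 + W)"
    have d: "0 < d" "d \<le> 1" "d * (2 + W) = 1"
      using W by (auto simp: d_def)
    then have d1: "1 - d = d * (1 + W)"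
      by (simp add: algebra_simps)
    have "bil N (mix (pure x) d (pure e)) (mix (pure y) (1/2) (pure e)) = 0"
    proof (rule z)
      have "bil M (mix (pure x) d (pure e)) (mix (pure y) (1/2) (pure e)) = k / 2 * (d * (2 + W) - 1)"
        by (simp add: bil_mix_left bil_mix_right M0 k W(2) field_simps)
      then show "bil M (mix (pure x) d (pure e)) (mix (pure y) (1/2) (pure e)) = 0"
        unfolding d(3) by simp
    qed (use d in \<open>auto intro!: outcomes_on_mix\<close>)
    then have "d * (N x y + N x e - (1 + W) * N y e) = 0"
      unfolding bil_mix_left d1 by (simp add: bil_mix_right M0 algebra_simps)
    then have "N x y + N x e = (1 + W) * N y e"
      using d by simp
    with 1 have "N x e = N y e"
      by (simp add: algebra_simps)
    with 1 W show ?thesis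
      by simp
  qed
  have "N x e = N y e \<and> k * N x y = M x y * N x e"
  proof (cases "M x y \<ge> 0")
    case True
    then show ?thesis
      using main [of x y] sgn k by blast
  next
    case False
    have "N y e = N x e \<and> k * N y x = M y x * N y e"
      using main [of y x] sgn k False skew(1) [of y x] by (simp add: insert_commute)
    then show ?thesis
      using skew(1) [of y x] skew(2) [of y x] by simp
  qed
  then show "N x e = N y e" "k * N x y = M x y * N x e"
    by auto
qed

subsection \<open>Preferences determined by pairwise comparisons\<close>

text \<open>For relations in \<open>Prefs_pc\<close> this is the matrix of the normalised SSB
  function on pure outcomes, so pairwise comparisons determine the whole relation.\<close>

definition comparison :: "'a::finite pref \<Rightarrow> 'a \<Rightarrow> 'a \<Rightarrow> real" where
  "comparison P a b = (if (pure a, pure b) \<in> P then 1 else if (pure b, pure a) \<in> P then - 1 else 0)"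

lemma comparison_skew:
  assumes "P \<in> Prefs"
  shows "comparison P a b = - comparison P b a"
  using convex_preference.asym [of P] assms
  by (auto simp: comparison_def convex_preference_def)

lemma comparison_self:
  assumes "P \<in> Prefs"
  shows "comparison P a a = 0"
  using comparison_skew [OF assms, of a a] by simp

lemma Phi_pc_bil:
  assumes "P \<in> Prefs" "\<phi> \<in> Phi_pc" "represents \<phi> P" "p \<in> outcomes" "q \<in> outcomes"
  shows "\<phi> p q = bil (comparison P) p q"
proof -
  have "\<phi> (pure a) (pure b) = comparison P a b" for a b
  proof -
    have "\<phi> (pure a) (pure b) \<in> {-1, 0, 1}" "\<phi> (pure b) (pure a) = - \<phi> (pure a) (pure b)"
      using assms SSB_skew pure_outcomes unfolding Phi_pc_def Phi_def by blast+
    then show ?thesis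
      using assms by (auto simp: comparison_def represents_def)
  qed
  then show ?thesis
    using SSB_bil [of \<phi> p q] assms by (simp add: Phi_pc_def Phi_def)
qed

lemma Prefs_pc_iff:
  assumes "P \<in> Prefs_pc" "p \<in> outcomes" "q \<in> outcomes"
  shows "(p, q) \<in> P \<longleftrightarrow> 0 < bil (comparison P) p q"
proof -
  obtain \<phi> where "P \<in> Prefs" "\<phi> \<in> Phi_pc" "represents \<phi> P"
    using assms(1) by (auto simp: Prefs_pc_def)
  then show ?thesis
    using Phi_pc_bil assms by (metis represents_def)
qed

text \<open>By uniqueness, \<open>\<phi>\<close> is a positive multiple of a function in
  \<open>Phi_pc\<close> representing the same relation. Unless both vanish, evaluating at a
  maximiser of each shows that the factor is 1.\<close>

lemma Phi_eq_bil:
  assumes "P \<in> Prefs_pc" "\<phi> \<in> Phi" "represents \<phi> P" and pq: "p \<in> outcomes" "q \<in> outcomes"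
  shows "\<phi> p q = bil (comparison P) p q"
proof -
  obtain \<psi> where \<psi>: "P \<in> Prefs" "\<psi> \<in> Phi_pc" "represents \<psi> P"
    using assms(1) by (auto simp: Prefs_pc_def)
  let ?M = "comparison P" and ?N = "\<lambda>a b. \<phi> (pure a) (pure b)"
  have \<psi>M: "\<psi> p q = bil ?M p q" if "p \<in> outcomes" "q \<in> outcomes" for p q
    using Phi_pc_bil \<psi> that by blast
  have \<phi>N: "\<phi> p q = bil ?N p q" if "p \<in> outcomes" "q \<in> outcomes" for p q
    using SSB_bil assms that by (auto simp: Phi_def)
  have skew: "?M a b = - ?M b a" "?N a b = - ?N b a" for a b
    using comparison_skew [OF \<psi>(1)] SSB_skew assms pure_outcomes unfolding Phi_def by blast+
  have pos: "0 < bil ?M p q \<longleftrightarrow> 0 < bil ?N p q" if "p \<in> outcomes" "q \<in> outcomes" for p q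
    using Prefs_pc_iff [OF assms(1) that] \<phi>N [OF that] assms(3) that by (simp add: represents_def)
  have sgn: "sgn (bil ?M p q) = sgn (bil ?N p q)" if "p \<in> outcomes" "q \<in> outcomes" for p q
    using pos [OF that] pos [OF that(2) that(1)] bil_skew [of ?M p q, OF skew(1)] bil_skew [of ?N p q, OF skew(2)]
    by (auto simp: sgn_if)
  obtain c where c: "0 < c" "\<And>p q. p \<in> outcomes \<Longrightarrow> q \<in> outcomes \<Longrightarrow> \<phi> p q = c * \<psi> p q"
    using SSB_matrix_unique [of ?M ?N, OF skew sgn] \<phi>N \<psi>M by metis
  have \<psi>Phi: "\<psi> \<in> Phi"
    using \<psi> by (simp add: Phi_pc_def)
  consider "\<forall>p\<in>outcomes. \<forall>q\<in>outcomes. \<phi> p q = 0" | "\<forall>p\<in>outcomes. \<forall>q\<in>outcomes. \<psi> p q = 0"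
    | p q p' q' where "p \<in> outcomes" "q \<in> outcomes" "\<phi> p q = 1" "p' \<in> outcomes" "q' \<in> outcomes" "\<psi> p' q' = 1"
      "\<psi> p q \<le> 1" "\<phi> p' q' \<le> 1"
    using assms(2) \<psi>Phi unfolding Phi_def by blast
  then have "\<phi> p q = \<psi> p q"
  proof cases
    case 1
    then show ?thesis
      using c pq by simp
  next
    case 2
    then show ?thesis
      using c pq by simp
  next
    case 3
    have "c \<le> 1"
      using 3 c by simp
    moreover have "1 \<le> c"
      using 3 c(2) [of p q] c(1) by (smt (verit) mult_left_le)
    ultimately show ?thesis
      using c(2) [OF pq] by simp
  qed
  then show ?thesis
    using \<psi>M pq by simp
qed

lemma comparison_perm:
  assumes "bij \<pi>"
  shows "comparison (perm_pref \<pi> P) (\<pi> a) (\<pi> b) = comparison P a b"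
proof -
  have "inv \<pi> x = a \<longleftrightarrow> x = \<pi> a" for x a
    using bij_inv_eq_iff [OF assms, of a x] by auto
  then have "pure (\<pi> a) = perm_outcome \<pi> (pure a)" for a
    by (simp add: perm_outcome_def pure_def axis_def vec_eq_iff)
  then show ?thesis
    using perm_pref_iff [OF assms] by (simp add: comparison_def)
qed

subsection \<open>Social margins\<close>

locale arrovian_SWF =
  fixes D :: "'a::finite pref set"
    and f :: "('n::finite \<Rightarrow> 'a pref) \<Rightarrow> 'a pref"
  assumes card_alternatives: "CARD('a) \<ge> 5"
    and domain: "D \<subseteq> Prefs_pc"
    and rich: "rich D"
    and arrovian: "arrovian D f"
begin

lemma domain_Prefs: "P \<in> D \<Longrightarrow> P \<in> Prefs"
  using domain by (auto simp: Prefs_pc_def)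

lemma fresh:
  fixes X :: "'a set"
  assumes "card X \<le> 4"
  obtains e where "e \<notin> X"
proof -
  have "X \<noteq> UNIV"
    using assms card_alternatives by auto
  then show thesis
    using that by blast
qed

lemma comparison_swap: "P \<in> D \<Longrightarrow> comparison P a b = - comparison P b a"
  using comparison_skew domain_Prefs by blast

lemma comparison_refl [simp]: "P \<in> D \<Longrightarrow> comparison P a a = 0"
  using comparison_self domain_Prefs by blast

lemma comparison_converse: "P \<in> D \<Longrightarrow> comparison (P\<inverse>) a b = comparison P b a"
  using convex_preference.asym [of P] domain_Prefs
  by (auto simp: comparison_def convex_preference_def)

lemma converse_domain: "P \<in> D \<Longrightarrow> P\<inverse> \<in> D"
  using rich by (auto simp: rich_def)

lemma empty_domain: "{} \<in> D"
  using rich by (simp add: rich_def)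

text \<open>Richness supplies some alternative below \<open>X\<close>, which irreflexivity keeps
  outside \<open>X\<close>. The transposition with \<open>e\<close> fixes \<open>X\<close> and puts
  \<open>e\<close> in its place.\<close>

lemma extend_below:
  assumes P: "P \<in> D" and X: "card X \<le> 4" and e: "e \<notin> X"
  shows "\<exists>Q\<in>D. (\<forall>x\<in>X. \<forall>y\<in>X. comparison Q x y = comparison P x y) \<and> (\<forall>x\<in>X. comparison Q x e = 1)"
proof -
  have "\<forall>P'\<in>D. \<forall>X. card X \<le> 4 \<longrightarrow> (\<exists>P\<in>D. \<exists>a. Restr P (pure ` X) = Restr P' (pure ` X) \<and>
      (\<forall>x\<in>X. (pure x, pure a) \<in> P))"
    using rich unfolding rich_def by (elim conjE)
  from bspec [OF this P] have "card X \<le> 4 \<longrightarrow>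
      (\<exists>Q\<in>D. \<exists>a. Restr Q (pure ` X) = Restr P (pure ` X) \<and> (\<forall>x\<in>X. (pure x, pure a) \<in> Q))"
    by (rule spec)
  from mp [OF this X]
  have "\<exists>Q\<in>D. \<exists>a. Restr Q (pure ` X) = Restr P (pure ` X) \<and> (\<forall>x\<in>X. (pure x, pure a) \<in> Q)" .
  then obtain Q a where Q: "Q \<in> D" "Restr Q (pure ` X) = Restr P (pure ` X)"
    "\<forall>x\<in>X. (pure x, pure a) \<in> Q"
    by (elim bexE exE conjE)
  have "(pure a, pure a) \<notin> Q"
    using convex_preference.irrefl [of Q] domain_Prefs [OF Q(1)] by (auto simp: convex_preference_def)
  then have a: "a \<notin> X"
    using Q by blast
  define \<pi> where "\<pi> = Transposition.transpose a e"
  have \<pi>: "bij \<pi>" "\<pi> a = e" "\<And>x. x \<in> X \<Longrightarrow> \<pi> x = x"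
    using a e by (auto simp: \<pi>_def Transposition.transpose_def)
  let ?Q = "perm_pref \<pi> Q"
  have "?Q \<in> D"
    using rich \<pi>(1) Q(1) domain_Prefs by (auto simp: rich_def)
  moreover have "comparison ?Q x y = comparison P x y" if "x \<in> X" "y \<in> X" for x y
  proof -
    have "comparison ?Q x y = comparison Q x y"
      using comparison_perm [OF \<pi>(1), of Q x y] \<pi>(3) that by simp
    moreover have "(pure x, pure y) \<in> Q \<longleftrightarrow> (pure x, pure y) \<in> P" "(pure y, pure x) \<in> Q \<longleftrightarrow> (pure y, pure x) \<in> P"
      using Q(2) that by blast+
    ultimately show ?thesis
      by (simp add: comparison_def)
  qed
  moreover have "comparison ?Q x e = 1" if "x \<in> X" for x
    using comparison_perm [OF \<pi>(1), of Q x a] \<pi>(2,3) that Q(3) by (simp add: comparison_def)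
  ultimately show ?thesis
    by blast
qed

lemma extend_above:
  assumes P: "P \<in> D" and X: "card X \<le> 4" and e: "e \<notin> X"
  shows "\<exists>Q\<in>D. (\<forall>x\<in>X. \<forall>y\<in>X. comparison Q x y = comparison P x y) \<and> (\<forall>x\<in>X. comparison Q e x = 1)"
proof -
  obtain Q where Q: "Q \<in> D" "\<forall>x\<in>X. \<forall>y\<in>X. comparison Q x y = comparison (P\<inverse>) x y"
    "\<forall>x\<in>X. comparison Q x e = 1"
    using extend_below [OF converse_domain [OF P] X e] by blast
  show ?thesis
    using Q P by (intro bexI [OF _ converse_domain [OF Q(1)]]) (simp add: comparison_converse)
qed

lemma profilesD: "R \<in> profiles D \<Longrightarrow> R i \<in> D"
  by (simp add: profiles_def)

lemma profile_choice:
  assumes "\<And>i. \<exists>Q\<in>D. A i Q"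
  shows "\<exists>R\<in>profiles D. \<forall>i. A i (R i)"
proof -
  obtain R where "\<forall>i. R i \<in> D \<and> A i (R i)"
    using choice [of "\<lambda>i Q. Q \<in> D \<and> A i Q"] assms by blast
  then show ?thesis
    by (intro bexI [of _ R]) (simp_all add: profiles_def)
qed

lemma profile_extend_below:
  assumes "R \<in> profiles D" "card X \<le> 4" "e \<notin> X"
  shows "\<exists>R'\<in>profiles D. \<forall>i. (\<forall>x\<in>X. \<forall>y\<in>X. comparison (R' i) x y = comparison (R i) x y)
    \<and> (\<forall>x\<in>X. comparison (R' i) x e = 1)"
  by (intro profile_choice extend_below assms profilesD)

lemma profile_extend_above:
  assumes "R \<in> profiles D" "card X \<le> 4" "e \<notin> X"
  shows "\<exists>R'\<in>profiles D. \<forall>i. (\<forall>x\<in>X. \<forall>y\<in>X. comparison (R' i) x y = comparison (R i) x y)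
    \<and> (\<forall>x\<in>X. comparison (R' i) e x = 1)"
  by (intro profile_choice extend_above assms profilesD)

text \<open>The scale is chosen separately for each profile, so across profiles only signs and
  ratios of entries can be compared.\<close>

definition social :: "('n \<Rightarrow> 'a pref) \<Rightarrow> 'a \<Rightarrow> 'a \<Rightarrow> real" where
  "social R = (SOME M. (\<forall>a b. M a b = - M b a) \<and> (\<forall>p\<in>outcomes. \<forall>q\<in>outcomes. (p, q) \<in> f R \<longleftrightarrow> 0 < bil M p q))"

lemma social:
  assumes "R \<in> profiles D"
  shows "social R a b = - social R b a"
    and "p \<in> outcomes \<Longrightarrow> q \<in> outcomes \<Longrightarrow> (p, q) \<in> f R \<longleftrightarrow> 0 < bil (social R) p q"
proof -
  have "convex_preference (f R)"
    using arrovian assms by (auto simp: arrovian_def SWF_def convex_preference_def)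
  then have "(\<forall>a b. social R a b = - social R b a) \<and>
      (\<forall>p\<in>outcomes. \<forall>q\<in>outcomes. (p, q) \<in> f R \<longleftrightarrow> 0 < bil (social R) p q)"
    unfolding social_def by (rule someI_ex [OF convex_preference.SSB_matrix])
  then show "social R a b = - social R b a"
    "p \<in> outcomes \<Longrightarrow> q \<in> outcomes \<Longrightarrow> (p, q) \<in> f R \<longleftrightarrow> 0 < bil (social R) p q"
    by blast+
qed

lemma social_self [simp]: "R \<in> profiles D \<Longrightarrow> social R a a = 0"
  using social(1) [of R a a] by simp

lemma bil_social_skew: "R \<in> profiles D \<Longrightarrow> bil (social R) p q = - bil (social R) q p"
  by (intro bil_skew social)

lemma bil_comparison_skew: "P \<in> D \<Longrightarrow> bil (comparison P) p q = - bil (comparison P) q p"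
  by (intro bil_skew comparison_swap)

lemma domain_iff:
  "P \<in> D \<Longrightarrow> p \<in> outcomes \<Longrightarrow> q \<in> outcomes \<Longrightarrow> (p, q) \<in> P \<longleftrightarrow> 0 < bil (comparison P) p q"
  using Prefs_pc_iff domain by blast

lemma weakly_pref_iff:
  assumes "P \<in> D" "p \<in> outcomes" "q \<in> outcomes"
  shows "weakly_pref P p q \<longleftrightarrow> 0 \<le> bil (comparison P) p q"
  using domain_iff [OF assms] domain_iff [OF assms(1,3,2)] bil_comparison_skew [OF assms(1), of p q] assms
  by (auto simp: weakly_pref_def indiff_def)

text \<open>Pareto optimality is used in both directions. Every unanimous indifference thereby
  becomes a linear equation for \<open>social R\<close>.\<close>

lemma pareto_indiff:
  assumes "R \<in> profiles D" "p \<in> outcomes" "q \<in> outcomes" "\<And>i. bil (comparison (R i)) p q = 0"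
  shows "bil (social R) p q = 0"
proof -
  have "bil (comparison (R i)) q p = 0" for i
    using bil_comparison_skew [OF profilesD [OF assms(1)], of i q p] assms(4) by simp
  then have "weakly_pref (R i) p q" "weakly_pref (R i) q p" for i
    using weakly_pref_iff [OF profilesD [OF assms(1)]] assms by auto
  then have "weakly_pref (f R) p q" "weakly_pref (f R) q p"
    using arrovian assms unfolding arrovian_def pareto_optimality_def by blast+
  then have "\<not> bil (social R) p q < 0" "\<not> bil (social R) q p < 0"
    using social(2) [OF assms(1-3)] social(2) [OF assms(1,3,2)] bil_social_skew [OF assms(1), of p q]
    by (auto simp: weakly_pref_def indiff_def)
  then show ?thesis
    using bil_social_skew [OF assms(1), of p q] by simp
qed

lemma pareto_strict:
  assumes "R \<in> profiles D" "\<And>i. comparison (R i) a b \<ge> 0" "comparison (R j) a b > 0"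
  shows "social R a b > 0"
proof -
  have "weakly_pref (R i) (pure a) (pure b)" for i
    using weakly_pref_iff [OF profilesD [OF assms(1)]] assms by simp
  moreover have "(pure a, pure b) \<in> R j"
    using domain_iff [OF profilesD [OF assms(1)], of "pure a" "pure b" j] assms by simp
  ultimately have "(pure a, pure b) \<in> f R"
    using arrovian assms pure_outcomes unfolding arrovian_def pareto_optimality_def by blast
  then show ?thesis
    using social(2) [OF assms(1), of "pure a" "pure b"] by simp
qed

text \<open>Relations in the domain are determined by pairwise comparisons, so equal comparisons on
  \<open>X\<close> give equal restrictions to all outcomes supported on \<open>X\<close>, as IIA
  requires.\<close>

lemma IIA_sgn:
  assumes R: "R \<in> profiles D" and R': "R' \<in> profiles D"
    and eq: "\<And>i x y. x \<in> X \<Longrightarrow> y \<in> X \<Longrightarrow> comparison (R i) x y = comparison (R' i) x y"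
    and pq: "p \<in> outcomes_on X" "q \<in> outcomes_on X"
  shows "sgn (bil (social R) p q) = sgn (bil (social R') p q)"
proof -
  have "Restr (R i) (outcomes_on X) = Restr (R' i) (outcomes_on X)" for i
  proof -
    have "(p, q) \<in> R i \<longleftrightarrow> (p, q) \<in> R' i" if "p \<in> outcomes_on X" "q \<in> outcomes_on X" for p q
      using domain_iff [OF profilesD [OF R], of p q i] domain_iff [OF profilesD [OF R'], of p q i]
        bil_cong_on [of p X q "comparison (R i)" 1 "comparison (R' i)"] eq that
      by (simp add: outcomes_onD)
    then show ?thesis
      by auto
  qed
  then have "Restr (f R) (outcomes_on X) = Restr (f R') (outcomes_on X)"
    using arrovian R R' unfolding arrovian_def IIA_def by blast
  then have "(p, q) \<in> f R \<longleftrightarrow> (p, q) \<in> f R'" "(q, p) \<in> f R \<longleftrightarrow> (q, p) \<in> f R'"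
    using pq by blast+
  then show ?thesis
    using social(2) [OF R, of p q] social(2) [OF R', of p q] social(2) [OF R, of q p] social(2) [OF R', of q p]
      bil_social_skew [OF R, of q p] bil_social_skew [OF R', of q p] pq outcomes_onD
    by (auto simp: sgn_if)
qed

text \<open>Every agent is indifferent between \<open>y\<close> and the midpoint of \<open>x\<close>
  and \<open>z\<close>.\<close>

lemma social_opposite:
  assumes R: "R \<in> profiles D" and eq: "\<And>i. comparison (R i) x y = comparison (R i) y z"
  shows "social R x y = social R y z"
proof -
  have "bil (social R) (pure y) (mix (pure x) (1/2) (pure z)) = 0"
  proof (rule pareto_indiff [OF R])
    show "bil (comparison (R i)) (pure y) (mix (pure x) (1/2) (pure z)) = 0" for i
      using eq [of i] comparison_swap [OF profilesD [OF R], of i y x] by (simp add: bil_mix_right)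
  qed (auto intro!: outcomes_mix)
  then show ?thesis
    using social(1) [OF R, of y x] by (simp add: bil_mix_right)
qed

lemma social_chain:
  assumes R: "R \<in> profiles D"
    and eq: "\<And>i. comparison (R i) x y = 1" "\<And>i. comparison (R i) y z = 1" "\<And>i. comparison (R i) x z = 1"
  shows "social R x y = social R y z" "social R x z = social R y z"
proof -
  show 1: "social R x y = social R y z"
    by (rule social_opposite [OF R]) (simp add: eq)
  \<comment> \<open>Up to a factor, the individual values are \<open>- 2 + 1 + 1\<close>, from
    \<open>x\<close> over \<open>y\<close>, \<open>y\<close> over \<open>z\<close> and
    \<open>x\<close> over \<open>z\<close>. The same combination of social margins is therefore
    zero.\<close>
  let ?p = "mix (pure y) (1/2) (pure x)" and ?q = "mix (pure x) (2/3) (pure z)"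
  have "bil (social R) ?p ?q = 0"
  proof (rule pareto_indiff [OF R])
    show "bil (comparison (R i)) ?p ?q = 0" for i
      using eq [of i] comparison_swap [OF profilesD [OF R], of i y x] profilesD [OF R]
      by (simp add: bil_mix_right bil_mix_left)
  qed (auto intro!: outcomes_mix)
  then show "social R x z = social R y z"
    using social(1) [OF R, of y x] 1 R by (simp add: bil_mix_right bil_mix_left)
qed

lemma bottom_pos:
  assumes "R \<in> profiles D" "\<And>i. comparison (R i) a e = 1"
  shows "social R a e > 0"
  by (rule pareto_strict [OF assms(1)]) (use assms in auto)

text \<open>An alternative \<open>t\<close> put above all three forms a chain with \<open>a\<close>,
  \<open>e\<close> and one with \<open>b\<close>, \<open>e\<close>, so its margin over
  \<open>e\<close> equals both others. IIA brings the equality back to \<open>R\<close> through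
  \<open>triple_ratio\<close>.\<close>

lemma bottom_equal:
  assumes R: "R \<in> profiles D" and e: "\<And>i. comparison (R i) a e = 1" "\<And>i. comparison (R i) b e = 1"
  shows "social R a e = social R b e"
proof -
  have card: "card {a, b, e} \<le> 4"
    by (simp add: card_insert_if)
  obtain t where t: "t \<notin> {a, b, e}"
    by (rule fresh [OF card])
  obtain R' where R': "R' \<in> profiles D"
    and eq: "\<And>i x y. x \<in> {a, b, e} \<Longrightarrow> y \<in> {a, b, e} \<Longrightarrow> comparison (R' i) x y = comparison (R i) x y"
    and top: "\<And>i x. x \<in> {a, b, e} \<Longrightarrow> comparison (R' i) t x = 1"
    using profile_extend_above [OF R card t] by blast
  have ae: "comparison (R' i) a e = 1" "comparison (R' i) b e = 1" for i
    using eq e by auto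
  have a: "social R' t e = social R' a e" and b: "social R' t e = social R' b e"
    using social_chain(2) [OF R' _ ae(1), of t] social_chain(2) [OF R' _ ae(2), of t] top by auto
  show ?thesis
  proof (rule triple_ratio(1) [OF social(1) [OF R'] social(1) [OF R]])
    show "social R' a e = social R' a e" "social R' b e = social R' a e"
      using a b by auto
    show "0 < social R' a e"
      by (rule bottom_pos [OF R' ae(1)])
  qed (rule IIA_sgn [OF R' R]; use eq in blast)
qed

text \<open>\<open>e\<close> is the unit of measurement for the social margin of \<open>b\<close> over \<open>a\<close>.\<close>

definition config :: "('n \<Rightarrow> real) \<Rightarrow> ('n \<Rightarrow> 'a pref) \<Rightarrow> 'a \<Rightarrow> 'a \<Rightarrow> 'a \<Rightarrow> bool" where
  "config s R b a e \<longleftrightarrow> R \<in> profiles D \<and> distinct [b, a, e] \<and>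
    (\<forall>i. comparison (R i) b a = s i \<and> comparison (R i) b e = 1 \<and> comparison (R i) a e = 1)"

text \<open>A configuration fixes all individual comparisons among \<open>b\<close>,
  \<open>a\<close>, \<open>e\<close>. So IIA yields equal signs there, from which
  \<open>triple_ratio\<close> recovers the ratio.\<close>

lemma config_ratio:
  assumes "config s R b a e" "config s R' b a e"
  shows "social R b a / social R a e = social R' b a / social R' a e"
proof -
  have R: "R \<in> profiles D" and R': "R' \<in> profiles D"
    and e: "\<And>i. comparison (R i) a e = 1" "\<And>i. comparison (R i) b e = 1"
    and e': "\<And>i. comparison (R' i) a e = 1" "\<And>i. comparison (R' i) b e = 1"
    and s: "\<And>i. comparison (R i) b a = s i" "\<And>i. comparison (R' i) b a = s i"
    using assms by (auto simp: config_def)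
  have eq: "comparison (R i) x y = comparison (R' i) x y" if "x \<in> {b, a, e}" "y \<in> {b, a, e}" for i x y
    using that e [of i] e' [of i] s [of i]
      comparison_swap [OF profilesD [OF R], of i e] comparison_swap [OF profilesD [OF R'], of i e]
      comparison_swap [OF profilesD [OF R], of i a b] comparison_swap [OF profilesD [OF R'], of i a b]
      comparison_refl [OF profilesD [OF R], of i] comparison_refl [OF profilesD [OF R'], of i]
    by auto
  have "social R a e * social R' b a = social R b a * social R' b e"
    by (rule triple_ratio(2) [OF social(1) [OF R] social(1) [OF R'] IIA_sgn [OF R R']])
      (use eq bottom_equal [OF R e] bottom_pos [OF R e(1)] in auto)
  then show ?thesis
    using bottom_pos [OF R e(1)] bottom_pos [OF R' e'(1)] bottom_equal [OF R' e'] by (simp add: field_simps)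
qed

section \<open>Neutrality: independence of the chosen alternatives\<close>

definition sign_vectors :: "('n \<Rightarrow> real) set" where
  "sign_vectors = {s. \<forall>i. s i \<in> {- 1, 0, 1}}"

lemma comparison_sign_vector: "(\<lambda>i. comparison (R i) a b) \<in> sign_vectors"
  by (simp add: sign_vectors_def comparison_def)

lemma config_profile: "config s R b a e \<Longrightarrow> R \<in> profiles D"
  by (simp add: config_def)

text \<open>Complete indifference serves for 0. Starting from it, two extensions from below build
  the strict chain, which is used in reverse order for \<open>- 1\<close>.\<close>

lemma ex_chain:
  assumes \<sigma>: "\<sigma> \<in> {- 1, 0, 1::real}" and abc: "distinct [b, a, c]"
  shows "\<exists>Q\<in>D. comparison Q b a = \<sigma> \<and> comparison Q a c = \<sigma> \<and> comparison Q b c = \<sigma>"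
proof -
  have up: "\<exists>Q\<in>D. comparison Q b a = 1 \<and> comparison Q a c = 1 \<and> comparison Q b c = 1"
    if abc: "distinct [b, a, c]" for b a c
  proof -
    obtain Q where Q: "Q \<in> D" "comparison Q b a = 1"
      using extend_below [OF empty_domain, of "{b}" a] abc by auto
    obtain Q' where "Q' \<in> D" "comparison Q' b a = 1" "comparison Q' b c = 1" "comparison Q' a c = 1"
      using extend_below [OF Q(1), of "{b, a}" c] abc Q by (auto simp: card_insert_if)
    then show ?thesis
      by blast
  qed
  consider "\<sigma> = 1" | "\<sigma> = 0" | "\<sigma> = - 1"
    using \<sigma> by auto
  then show ?thesis
  proof cases
    case 1
    then show ?thesis using up [OF abc] by simp
  next
    case 2
    then show ?thesis using empty_domain by (intro bexI [of _ "{}"]) (auto simp: comparison_def)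
  next
    case 3
    obtain Q where "Q \<in> D" "comparison Q c a = 1" "comparison Q a b = 1" "comparison Q c b = 1"
      using up [of c a b] abc by auto
    then show ?thesis
      using 3 comparison_swap [of Q b a] comparison_swap [of Q a c] comparison_swap [of Q b c]
      by (intro bexI [of _ Q]) auto
  qed
qed

text \<open>Several configurations for the same \<open>s\<close> coexist in one profile, so their
  margins can be compared within one social matrix. The units \<open>e\<close> and \<open>e'\<close>
  are added below one after the other.\<close>

lemma ex_chain_config:
  assumes s: "s \<in> sign_vectors" and d: "distinct [b, a, c, e, e']"
  shows "\<exists>R. config s R b a e \<and> config s R a c e \<and> config s R b a e' \<and> (\<forall>i. comparison (R i) e e' = 1)"
proof -
  have "\<exists>R\<in>profiles D. \<forall>i. comparison (R i) b a = s i \<and> comparison (R i) a c = s i \<and> comparison (R i) b c = s i"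
    by (intro profile_choice ex_chain) (use s d in \<open>auto simp: sign_vectors_def\<close>)
  then obtain R0 where R0: "R0 \<in> profiles D"
    "\<And>i. comparison (R0 i) b a = s i" "\<And>i. comparison (R0 i) a c = s i"
    by blast
  obtain R1 where R1: "R1 \<in> profiles D"
    and eq1: "\<And>i x y. x \<in> {b, a, c} \<Longrightarrow> y \<in> {b, a, c} \<Longrightarrow> comparison (R1 i) x y = comparison (R0 i) x y"
    and e1: "\<And>i x. x \<in> {b, a, c} \<Longrightarrow> comparison (R1 i) x e = 1"
    using profile_extend_below [OF R0(1), of "{b, a, c}" e] d by (auto simp: card_insert_if)
  obtain R2 where R2: "R2 \<in> profiles D"
    and eq2: "\<And>i x y. x \<in> {b, a, c, e} \<Longrightarrow> y \<in> {b, a, c, e} \<Longrightarrow> comparison (R2 i) x y = comparison (R1 i) x y"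
    and e2: "\<And>i x. x \<in> {b, a, c, e} \<Longrightarrow> comparison (R2 i) x e' = 1"
    using profile_extend_below [OF R1, of "{b, a, c, e}" e'] d by (auto simp: card_insert_if)
  show ?thesis
    using d R2 R0(2,3) eq1 e1 eq2 e2 by (intro exI [of _ R2]) (simp add: config_def)
qed

lemma ex_config:
  assumes "s \<in> sign_vectors" "distinct [b, a, e]"
  shows "\<exists>R. config s R b a e"
proof -
  obtain c where c: "c \<notin> {b, a, e}"
    by (rule fresh [of "{b, a, e}"]) (auto simp: card_insert_if)
  obtain e' where "e' \<notin> {b, a, e, c}"
    by (rule fresh [of "{b, a, e, c}"]) (auto simp: card_insert_if)
  then show ?thesis
    using ex_chain_config [OF assms(1), of b a c e e'] assms c by auto
qed

definition ratio :: "('n \<Rightarrow> real) \<Rightarrow> 'a \<Rightarrow> 'a \<Rightarrow> 'a \<Rightarrow> real" where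
  "ratio s b a e = (let R = SOME R. config s R b a e in social R b a / social R a e)"

lemma ratio_eq:
  assumes "config s R b a e"
  shows "social R b a = ratio s b a e * social R a e"
proof -
  have "config s (SOME R. config s R b a e) b a e"
    by (rule someI [of "\<lambda>R. config s R b a e", OF assms])
  then have "ratio s b a e = social R b a / social R a e"
    unfolding ratio_def Let_def using assms by (rule config_ratio)
  moreover have "social R a e > 0"
    using assms by (intro bottom_pos) (auto simp: config_def)
  ultimately show ?thesis
    by simp
qed

text \<open>Change of unit: everyone ranks \<open>a\<close> above \<open>e\<close> above
  \<open>e'\<close>, so \<open>social_chain\<close> equates the two units. Change of pair:
  \<open>b\<close> is compared with \<open>a\<close> as \<open>a\<close> is with \<open>c\<close>,
  so \<open>social_opposite\<close> equates the margins.\<close>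

lemma ratio_shift:
  assumes s: "s \<in> sign_vectors" and d: "distinct [b, a, c, e, e']"
  shows "ratio s b a e = ratio s b a e'" "ratio s b a e = ratio s a c e"
proof -
  obtain R where R: "config s R b a e" "config s R a c e" "config s R b a e'" "\<And>i. comparison (R i) e e' = 1"
    using ex_chain_config [OF assms] by blast
  have RD: "R \<in> profiles D"
    using R config_profile by blast
  have ae: "comparison (R i) a e = 1" "comparison (R i) c e = 1" "comparison (R i) a e' = 1" for i
    using R by (auto simp: config_def)
  have pos: "social R a e > 0"
    by (rule bottom_pos [OF RD ae(1)])
  have "social R a e = social R a e'"
    using social_chain [OF RD ae(1) R(4) ae(3)] by simp
  then show "ratio s b a e = ratio s b a e'"
    using ratio_eq [OF R(1)] ratio_eq [OF R(3)] pos by simp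
  have "social R b a = social R a c"
    by (rule social_opposite [OF RD]) (use R in \<open>simp add: config_def\<close>)
  moreover have "social R a e = social R c e"
    by (rule bottom_equal [OF RD ae(1,2)])
  ultimately show "ratio s b a e = ratio s a c e"
    using ratio_eq [OF R(1)] ratio_eq [OF R(2)] pos by simp
qed

text \<open>The unit is exchanged first. Shifts from \<open>(b, a)\<close> to \<open>(a, c)\<close>
  then link all ordered pairs: two shifts with a common start replace the second alternative, and a
  further shift changes the first.\<close>

lemma ratio_const:
  assumes s: "s \<in> sign_vectors" and d: "distinct [b, a, e]" and d': "distinct [b', a', e']"
  shows "ratio s b a e = ratio s b' a' e'"
proof -
  have ee: "ratio s b a e = ratio s b a e'" if d: "distinct [b, a, e]" "distinct [b, a, e']" for b a e e'
  proof (cases "e = e'")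
    case False
    obtain c where "c \<notin> {b, a, e, e'}"
      by (rule fresh [of "{b, a, e, e'}"]) (auto simp: card_insert_if)
    then show ?thesis
      using ratio_shift(1) [OF s, of b a c e e'] False d by auto
  qed simp
  define F where "F = (\<lambda>b a. ratio s b a (SOME e. e \<notin> {b, a}))"
  have F: "ratio s b a e = F b a" if "distinct [b, a, e]" for b a e
  proof -
    have "(SOME e. e \<notin> {b, a}) \<notin> {b, a}"
      by (rule someI [of "\<lambda>e. e \<notin> {b, a}" e]) (use that in auto)
    then show ?thesis
      unfolding F_def using that by (intro ee) auto
  qed
  have shift: "F b a = F a c" if d: "distinct [b, a, c]" for b a c
  proof -
    obtain e where e: "e \<notin> {b, a, c}"
      by (rule fresh [of "{b, a, c}"]) (auto simp: card_insert_if)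
    obtain e' where "e' \<notin> {b, a, c, e}"
      by (rule fresh [of "{b, a, c, e}"]) (auto simp: card_insert_if)
    then show ?thesis
      using ratio_shift(2) [OF s, of b a c e e'] F [of b a e] F [of a c e] d e by auto
  qed
  have row: "F a c = F a c'" if "a \<noteq> c" "a \<noteq> c'" for a c c'
  proof -
    obtain b where "b \<notin> {a, c, c'}"
      by (rule fresh [of "{a, c, c'}"]) (auto simp: card_insert_if)
    then show ?thesis
      using shift [of b a c] shift [of b a c'] that by auto
  qed
  have "F b a = F b' a'" if "b \<noteq> a" "b' \<noteq> a'" for b a b' a'
  proof (cases "b = b'")
    case True
    then show ?thesis
      using row that by blast
  next
    case False
    obtain c where c: "c \<notin> {b, b', a'}"
      by (rule fresh [of "{b, b', a'}"]) (auto simp: card_insert_if)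
    have "F b a = F b b'"
      using row that False by blast
    also have "\<dots> = F b' c"
      using shift [of b b' c] c False by auto
    also have "\<dots> = F b' a'"
      using row [of b' c a'] that c by auto
    finally show ?thesis .
  qed
  then show ?thesis
    using F d d' by auto
qed

text \<open>By \<open>ratio_const\<close> all candidates agree for a sign vector \<open>s\<close>:
  this is the social margin caused by \<open>s\<close>, measured by the margin over a unanimously
  worst alternative.\<close>

definition omega :: "('n \<Rightarrow> real) \<Rightarrow> real" where
  "omega s = (SOME v. \<exists>b a e. distinct [b, a, e] \<and> v = ratio s b a e)"

lemma omega:
  assumes "config s R b a e"
  shows "social R b a = omega s * social R a e"
proof -
  have d: "distinct [b, a, e]"
    using assms by (simp add: config_def)
  then have "\<exists>v. \<exists>b a e. distinct [b, a, e] \<and> v = ratio s b a e"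
    by blast
  then have "\<exists>b a e. distinct [b, a, e] \<and> omega s = ratio s b a e"
    unfolding omega_def by (rule someI_ex)
  then obtain b' a' e' where "distinct [b', a', e']" "omega s = ratio s b' a' e'"
    by blast
  moreover have "s \<in> sign_vectors"
  proof -
    have "s = (\<lambda>i. comparison (R i) b a)"
      using assms by (auto simp: config_def)
    then show ?thesis
      using comparison_sign_vector by simp
  qed
  ultimately show ?thesis
    using ratio_eq [OF assms] ratio_const d by metis
qed

lemma ex_three: "\<exists>b a e :: 'a. distinct [b, a, e]"
proof -
  obtain b :: 'a where True
    by blast
  obtain a where a: "a \<notin> {b}"
    by (rule fresh [of "{b}"]) auto
  obtain e where "e \<notin> {b, a}"
    by (rule fresh [of "{b, a}"]) (auto simp: card_insert_if)
  with a show ?thesis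
    by (intro exI [of _ b] exI [of _ a] exI [of _ e]) auto
qed

text \<open>One profile is a configuration for \<open>s\<close> and, with \<open>a\<close> and
  \<open>b\<close> exchanged, for its negative.\<close>

lemma omega_minus:
  assumes s: "s \<in> sign_vectors"
  shows "omega (\<lambda>i. - s i) = - omega s"
proof -
  obtain b a e :: 'a where d: "distinct [b, a, e]"
    using ex_three by blast
  obtain R where R: "config s R b a e"
    using ex_config [OF s d] by blast
  then have RD: "R \<in> profiles D"
    by (rule config_profile)
  have e: "comparison (R i) a e = 1" "comparison (R i) b e = 1" for i
    using R by (auto simp: config_def)
  have "config (\<lambda>i. - s i) R a b e"
    using R comparison_swap [OF profilesD [OF RD], of _ a b] by (auto simp: config_def)
  then have "social R a b = omega (\<lambda>i. - s i) * social R b e"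
    by (rule omega)
  moreover have "social R b a = omega s * social R a e"
    by (rule omega [OF R])
  moreover have "social R a e = social R b e"
    by (rule bottom_equal [OF RD e])
  ultimately have "omega (\<lambda>i. - s i) * social R a e = (- omega s) * social R a e"
    using social(1) [OF RD, of a b] by simp
  then show ?thesis
    using bottom_pos [OF RD e(1)] by (simp only: mult_cancel_right) simp
qed

section \<open>Additivity and weights\<close>

text \<open>This is one agent's preference in the profile for \<open>omega_add\<close>, where at
  least one of \<open>b\<close>, \<open>c\<close> is indifferent to \<open>a\<close>. From complete
  indifference, \<open>b\<close> is put above and \<open>d\<close> below, or the other way
  round.\<close>

lemma ex_star:
  assumes \<sigma>: "\<sigma> \<in> {- 1, 0, 1::real}" and d: "distinct [a, b, c, d]"
  shows "\<exists>Q\<in>D. comparison Q b a = \<sigma> \<and> comparison Q c a = 0 \<and> comparison Q a d = \<sigma>"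
proof -
  have up: "\<exists>Q\<in>D. comparison Q b a = 1 \<and> comparison Q c a = 0 \<and> comparison Q a d = 1"
    if d: "distinct [a, b, c, d]" for b d
  proof -
    obtain Q where Q: "Q \<in> D" "comparison Q c a = comparison {} c a" "comparison Q b a = 1"
      using extend_above [OF empty_domain, of "{a, c}" b] d by (auto simp: card_insert_if)
    obtain Q' where "Q' \<in> D" "comparison Q' c a = comparison Q c a" "comparison Q' b a = comparison Q b a"
      "comparison Q' a d = 1"
      using extend_below [OF Q(1), of "{a, b, c}" d] d by (auto simp: card_insert_if)
    then show ?thesis
      using Q by (intro bexI [of _ Q']) (auto simp: comparison_def)
  qed
  consider "\<sigma> = 1" | "\<sigma> = 0" | "\<sigma> = - 1"
    using \<sigma> by auto
  then show ?thesis
  proof cases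
    case 1
    then show ?thesis using up [OF d] by simp
  next
    case 2
    then show ?thesis using empty_domain by (intro bexI [of _ "{}"]) (auto simp: comparison_def)
  next
    case 3
    obtain Q where "Q \<in> D" "comparison Q d a = 1" "comparison Q c a = 0" "comparison Q a b = 1"
      using up [of d b] d by auto
    then show ?thesis
      using 3 comparison_swap [of Q b a] comparison_swap [of Q a d]
      by (intro bexI [of _ Q]) auto
  qed
qed

text \<open>Let \<open>b\<close>, \<open>c\<close>, \<open>d\<close> be compared with
  \<open>a\<close> by \<open>s\<close>, \<open>t\<close> and \<open>- (s + t)\<close>. The
  comparisons cancel in the uniform mixture of \<open>b\<close>, \<open>c\<close>, \<open>d\<close>,
  so everyone, hence society, is indifferent between it and \<open>a\<close>. Disjoint supports keep
  \<open>s + t\<close> a sign vector.\<close>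

lemma omega_add:
  assumes s: "s \<in> sign_vectors" and t: "t \<in> sign_vectors" and disj: "\<And>i. s i = 0 \<or> t i = 0"
  shows "omega (\<lambda>i. s i + t i) = omega s + omega t"
proof -
  obtain b a c :: 'a where d3: "distinct [b, a, c]"
    using ex_three by blast
  obtain d where d4: "d \<notin> {b, a, c}"
    by (rule fresh [of "{b, a, c}"]) (auto simp: card_insert_if)
  obtain e where d5: "e \<notin> {b, a, c, d}"
    by (rule fresh [of "{b, a, c, d}"]) (auto simp: card_insert_if)
  have "\<exists>R\<in>profiles D. \<forall>i. comparison (R i) b a = s i \<and> comparison (R i) c a = t i \<and> comparison (R i) a d = s i + t i"
  proof (rule profile_choice)
    fix i
    have "s i \<in> {- 1, 0, 1}" "t i \<in> {- 1, 0, 1}"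
      using s t by (auto simp: sign_vectors_def)
    then show "\<exists>Q\<in>D. comparison Q b a = s i \<and> comparison Q c a = t i \<and> comparison Q a d = s i + t i"
      using disj [of i] ex_star [of "s i" a b c d] ex_star [of "t i" a c b d] d3 d4 by auto
  qed
  then obtain R0 where R0: "R0 \<in> profiles D" "\<And>i. comparison (R0 i) b a = s i"
    "\<And>i. comparison (R0 i) c a = t i" "\<And>i. comparison (R0 i) a d = s i + t i"
    by blast
  have card: "card {b, a, c, d} \<le> 4"
    by (simp add: card_insert_if)
  obtain R where R: "R \<in> profiles D"
    and eq: "\<And>i x y. x \<in> {b, a, c, d} \<Longrightarrow> y \<in> {b, a, c, d} \<Longrightarrow> comparison (R i) x y = comparison (R0 i) x y"
    and e: "\<And>i x. x \<in> {b, a, c, d} \<Longrightarrow> comparison (R i) x e = 1"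
    using profile_extend_below [OF R0(1) card d5] by blast
  have val: "comparison (R i) b a = s i" "comparison (R i) c a = t i" "comparison (R i) d a = - (s i + t i)" for i
    using eq R0 comparison_swap [OF profilesD [OF R], of i d a] by auto
  have conf: "config s R b a e" "config t R c a e" "config (\<lambda>i. - (s i + t i)) R d a e"
    using R val e d3 d4 d5 by (auto simp: config_def)
  have st: "(\<lambda>i. s i + t i) \<in> sign_vectors"
    unfolding sign_vectors_def
  proof (intro CollectI allI)
    fix i
    have "s i \<in> {- 1, 0, 1}" "t i \<in> {- 1, 0, 1}"
      using s t by (simp_all add: sign_vectors_def)
    then show "s i + t i \<in> {- 1, 0, 1}"
      using disj [of i] by auto
  qed
  have "bil (social R) (mix (pure b) (1/3) (mix (pure c) (1/2) (pure d))) (pure a) = 0"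
  proof (rule pareto_indiff [OF R])
    show "bil (comparison (R i)) (mix (pure b) (1/3) (mix (pure c) (1/2) (pure d))) (pure a) = 0" for i
      using val [of i] by (simp add: bil_mix_left field_simps)
  qed (auto intro!: outcomes_mix)
  then have "social R b a + social R c a + social R d a = 0"
    by (simp add: bil_mix_left field_simps)
  then have "(omega s + omega t + omega (\<lambda>i. - (s i + t i))) * social R a e = 0"
    using conf [THEN omega] by (simp add: algebra_simps)
  moreover have "social R a e > 0"
    by (rule bottom_pos [OF R]) (use e in simp)
  ultimately show ?thesis
    using omega_minus [OF st] by simp
qed

definition weight :: "'n \<Rightarrow> real" where
  "weight j = omega (\<lambda>i. if i = j then 1 else 0)"

lemma unit_sign_vector: "(\<lambda>i. if i = j then 1 else 0) \<in> sign_vectors"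
  by (simp add: sign_vectors_def)

text \<open>Only agent \<open>j\<close> is strict and all others are indifferent, so the strict part
  of Pareto optimality applies.\<close>

lemma weight_pos: "weight j > 0"
proof -
  obtain b a e :: 'a where d: "distinct [b, a, e]"
    using ex_three by blast
  obtain R where R: "config (\<lambda>i. if i = j then 1 else 0) R b a e"
    using ex_config [OF unit_sign_vector d] by blast
  then have RD: "R \<in> profiles D"
    by (rule config_profile)
  have "social R b a > 0"
    by (rule pareto_strict [OF RD, of _ _ j]) (use R in \<open>simp_all add: config_def\<close>)
  moreover have "social R a e > 0"
    by (rule bottom_pos [OF RD]) (use R in \<open>simp add: config_def\<close>)
  ultimately show ?thesis
    using omega [OF R] by (simp add: weight_def zero_less_mult_iff)
qed

text \<open>A sign vector is the sum of its parts on single agents, and their supports are disjoint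
  as \<open>omega_add\<close> demands.\<close>

lemma omega_linear:
  assumes s: "s \<in> sign_vectors"
  shows "omega s = (\<Sum>i\<in>UNIV. weight i * s i)"
proof -
  \<comment> \<open>The zero vector is its own negative, so \<open>omega_minus\<close> makes
    \<open>omega\<close> vanish there.\<close>
  have zero: "(\<lambda>i. 0) \<in> sign_vectors"
    by (simp add: sign_vectors_def)
  have unit: "omega (\<lambda>i. if i = j then s i else 0) = weight j * s j" for j
  proof -
    consider "s j = - 1" | "s j = 0" | "s j = 1"
      using s by (auto simp: sign_vectors_def)
    then show ?thesis
    proof cases
      case 1
      then have "(\<lambda>i. if i = j then s i else 0) = (\<lambda>i. - (if i = j then 1 else 0))"
        by auto
      then show ?thesis
        using omega_minus [OF unit_sign_vector, of j] 1 by (simp add: weight_def)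
    next
      case 2
      then have "(\<lambda>i. if i = j then s i else 0) = (\<lambda>i. 0)"
        by auto
      then show ?thesis
        using omega_minus [OF zero] 2 by simp
    next
      case 3
      then have "(\<lambda>i. if i = j then s i else 0) = (\<lambda>i. if i = j then 1 else 0)"
        by auto
      then show ?thesis
        using 3 by (simp add: weight_def)
    qed
  qed
  have "omega (\<lambda>i. if i \<in> A then s i else 0) = (\<Sum>i\<in>A. weight i * s i)" for A
  proof (induction A rule: finite_induct [OF finite])
    case 1
    then show ?case
      using omega_minus [OF zero] by simp
  next
    case (2 j A)
    have "omega (\<lambda>i. (if i = j then s i else 0) + (if i \<in> A then s i else 0))
        = weight j * s j + (\<Sum>i\<in>A. weight i * s i)"
    proof (subst omega_add)
      show "(\<lambda>i. if i = j then s i else 0) \<in> sign_vectors" "(\<lambda>i. if i \<in> A then s i else 0) \<in> sign_vectors"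
        using s by (simp_all add: sign_vectors_def)
      show "(if i = j then s i else 0) = 0 \<or> (if i \<in> A then s i else 0) = 0" for i
        using 2 by auto
    qed (simp add: unit 2)
    moreover have "(\<lambda>i. (if i = j then s i else 0) + (if i \<in> A then s i else 0)) = (\<lambda>i. if i \<in> insert j A then s i else 0)"
      using 2 by auto
    ultimately show ?case
      using 2 by simp
  qed
  from this [of UNIV] show ?thesis
    by simp
qed

text \<open>Two edges leave a further alternative free to serve as unit in an extended profile.
  There \<open>omega_linear\<close> gives the social matrix up to a positive factor, and IIA returns
  the signs to \<open>R\<close>.\<close>

lemma social_sgn:
  assumes R: "R \<in> profiles D" and pq: "p \<in> outcomes" "q \<in> outcomes"
  shows "sgn (bil (\<lambda>a b. \<Sum>i\<in>UNIV. weight i * comparison (R i) a b) p q) = sgn (bil (social R) p q)"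
proof (rule sgn_bil_edges [OF _ pq])
  fix a b c d :: 'a and l m :: real
  assume lm: "0 \<le> l" "l \<le> 1" "0 \<le> m" "m \<le> 1"
  let ?X = "{a, b, c, d}" and ?W = "\<lambda>a b. \<Sum>i\<in>UNIV. weight i * comparison (R i) a b"
  let ?p = "mix (pure a) l (pure b)" and ?q = "mix (pure c) m (pure d)"
  have pq: "?p \<in> outcomes_on ?X" "?q \<in> outcomes_on ?X"
    using lm by (auto intro!: outcomes_on_mix)
  have card: "card ?X \<le> 4"
    by (simp add: card_insert_if)
  obtain e where e: "e \<notin> ?X"
    by (rule fresh [OF card])
  obtain R' where R': "R' \<in> profiles D"
    and eq: "\<And>i x y. x \<in> ?X \<Longrightarrow> y \<in> ?X \<Longrightarrow> comparison (R' i) x y = comparison (R i) x y"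
    and bot: "\<And>i x. x \<in> ?X \<Longrightarrow> comparison (R' i) x e = 1"
    using profile_extend_below [OF R card e] by blast
  \<comment> \<open>All margins over \<open>e\<close> coincide, so one factor serves for all pairs
    in \<open>?X\<close>.\<close>
  have k: "social R' y e = social R' a e" if "y \<in> ?X" for y
    using bottom_equal [OF R', of y e a] bot that by auto
  have "social R' x y = social R' a e * ?W x y" if xy: "x \<in> ?X" "y \<in> ?X" for x y
  proof (cases "x = y")
    case True
    then show ?thesis
      using R R' by (simp add: profilesD)
  next
    case False
    have "config (\<lambda>i. comparison (R i) x y) R' x y e"
      using R' eq bot xy False e unfolding config_def by auto
    then show ?thesis
      using omega [of "\<lambda>i. comparison (R i) x y" R' x y e] omega_linear [OF comparison_sign_vector [of R x y]] k [OF xy(2)]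
      by simp
  qed
  then have "bil (social R') ?p ?q = social R' a e * bil ?W ?p ?q"
    by (rule bil_cong_on [OF pq])
  moreover have "social R' a e > 0"
    by (rule bottom_pos [OF R']) (use bot in simp)
  ultimately have "sgn (bil (social R') ?p ?q) = sgn (bil ?W ?p ?q)"
    by (simp add: sgn_mult)
  moreover have "sgn (bil (social R') ?p ?q) = sgn (bil (social R) ?p ?q)"
    by (rule IIA_sgn [OF R' R eq pq])
  ultimately show "sgn (bil ?W ?p ?q) = sgn (bil (social R) ?p ?q)"
    by simp
qed

end

theorem theorem2:
  fixes D :: "'a::finite pref set"
    and f :: "('n::finite \<Rightarrow> 'a pref) \<Rightarrow> 'a pref"
  assumes "CARD('a) \<ge> 5"
    and "CARD('n) \<ge> 2"
    and "D \<subseteq> Prefs_pc"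
    and "rich D"
    and "arrovian D f"
  shows "\<exists>w :: 'n \<Rightarrow> real. (\<forall>i. w i > 0) \<and>
    (\<forall>R\<in>profiles D. \<forall>\<phi> :: 'n \<Rightarrow> 'a ssb_fun.
       (\<forall>i. \<phi> i \<in> Phi \<and> represents (\<phi> i) (R i)) \<longrightarrow>
       represents (\<lambda>p q. \<Sum>i\<in>UNIV. w i * \<phi> i p q) (f R))"
proof -
  interpret arrovian_SWF D f
    by unfold_locales (use assms in auto)
  show ?thesis
  proof (intro exI [of _ weight] conjI allI ballI impI)
    fix R :: "'n \<Rightarrow> 'a pref" and \<phi> :: "'n \<Rightarrow> 'a ssb_fun"
    assume R: "R \<in> profiles D" and \<phi>: "\<forall>i. \<phi> i \<in> Phi \<and> represents (\<phi> i) (R i)"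
    show "represents (\<lambda>p q. \<Sum>i\<in>UNIV. weight i * \<phi> i p q) (f R)"
      unfolding represents_def
    proof (intro ballI)
      fix p q :: "real ^ 'a"
      assume pq: "p \<in> outcomes" "q \<in> outcomes"
      \<comment> \<open>The \<open>\<phi> i\<close> are arbitrary representatives in
        \<open>Phi\<close>; normalisation identifies them with the comparison forms.\<close>
      have "\<phi> i p q = bil (comparison (R i)) p q" for i
        using Phi_eq_bil [OF _ _ _ pq] profilesD [OF R] domain \<phi> by blast
      then have "(\<Sum>i\<in>UNIV. weight i * \<phi> i p q)
          = (\<Sum>i\<in>UNIV. \<Sum>a\<in>UNIV. \<Sum>b\<in>UNIV. p $ a * q $ b * (weight i * comparison (R i) a b))"
        by (simp add: bil_def sum_distrib_left mult_ac)
      also have "\<dots> = (\<Sum>a\<in>UNIV. \<Sum>b\<in>UNIV. \<Sum>i\<in>UNIV. p $ a * q $ b * (weight i * comparison (R i) a b))"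
        by (subst sum.swap, intro sum.cong refl, rule sum.swap)
      also have "\<dots> = bil (\<lambda>a b. \<Sum>i\<in>UNIV. weight i * comparison (R i) a b) p q"
        by (simp add: bil_def sum_distrib_left)
      finally have "sgn (\<Sum>i\<in>UNIV. weight i * \<phi> i p q) = sgn (bil (social R) p q)"
        using social_sgn [OF R pq] by simp
      then have "0 < (\<Sum>i\<in>UNIV. weight i * \<phi> i p q) \<longleftrightarrow> 0 < bil (social R) p q"
        by (metis sgn_1_pos)
      then show "(p, q) \<in> f R \<longleftrightarrow> 0 < (\<Sum>i\<in>UNIV. weight i * \<phi> i p q)"
        using social(2) [OF R pq] by simp
    qed
  qed (rule weight_pos)
qed

end
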